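(* The Ramanujan-Wilton function $\Lambda(\varphi)=\xi_\tau(6+i\varphi)$, $\varphi\in\mathbb{C}$, is an even entire function of order $\lambda=1$.
   Context: The Ramanujan function $\tau(m)$ is defined by $q\prod_{n=1}^\infty(1-q^n)^{24}=\sum_{m=1}^\infty\tau(m)q^m$. The Ramanujan zeta function is $H_\tau(x)=\sum_{\ell=1}^\infty \tau(\ell)\ell^{-x}$ for $\Re(x)>13/2$, and $H_\tau$ also denotes its analytic continuation to $\mathbb{C}$. The Ramanujan-Rankin function is $\xi_\tau(x)=(2\pi)^{-x}\Gamma(x)H_\tau(x)$, understood as extended to $\mathbb{C}$ (removing removable singularities). The order of an entire function $f$ is its order of growth $\limsup_{r\to\infty}\frac{\ln\ln\max_{|z|=r}|f(z)|}{\ln r}$. *)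

theory Defs
  imports "HOL-Complex_Analysis.Complex_Analysis"
begin

text \<open>
  The product is an infinite product of formal power series; it converges in the metric topology
  of \<^typ>\<open>int fps\<close> (each coefficient is eventually constant).
\<close>

definition ramanujan_tau :: "nat \<Rightarrow> int" where
  "ramanujan_tau m = fps_nth (fps_X * (\<Prod>n. (1 - fps_X ^ Suc n) ^ 24)) m"

text \<open>
  The entire function that agrees with the Dirichlet series, which is required to converge, on the
  half-plane to the right of \<open>13/2\<close>. There is at most one such function, by the identity theorem;
  that there is one is not built into the definition.
\<close>

definition ramanujan_zeta :: "complex \<Rightarrow> complex" where
  "ramanujan_zeta = (THE H. H holomorphic_on UNIV \<and>
     (\<forall>x. Re x > 13 / 2 \<longrightarrow>
        (\<lambda>l. of_int (ramanujan_tau (Suc l)) * of_nat (Suc l) powr (- x)) sums H x))"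

text \<open>
  \<^const>\<open>Gamma\<close> is 0 at its poles; \<^const>\<open>remove_sings\<close> replaces the values there by limits.
\<close>

definition ramanujan_rankin_xi :: "complex \<Rightarrow> complex" where
  "ramanujan_rankin_xi =
     remove_sings (\<lambda>x. of_real (2 * pi) powr (- x) * Gamma x * ramanujan_zeta x)"

definition ramanujan_wilton :: "complex \<Rightarrow> complex" where
  "ramanujan_wilton \<phi> = ramanujan_rankin_xi (6 + \<i> * \<phi>)"

definition max_modulus :: "(complex \<Rightarrow> complex) \<Rightarrow> real \<Rightarrow> real" where
  "max_modulus f r = (SUP z\<in>sphere 0 r. norm (f z))"

text \<open>
  For constant \<open>f\<close> the inner logarithm may be nonpositive; the quotient still tends to 0,
  the usual order of a constant.
\<close>

definition growth_order :: "(complex \<Rightarrow> complex) \<Rightarrow> ereal" where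
  "growth_order f = Limsup at_top (\<lambda>r. ereal (ln (ln (max_modulus f r)) / ln r))"

end

theory Submission
  imports Defs "HOL-Real_Asymp.Real_Asymp"
begin


text \<open>
  The idea is Hecke's. The generating function \<open>\<Delta> = \<Sum> \<tau>(n) q\<^sup>n\<close> satisfies
  \<open>\<Delta>(-1/t) = t\<^sup>1\<^sup>2 \<Delta>(t)\<close>, so \<open>K(u) = e\<^sup>6\<^sup>u \<Delta>(i e\<^sup>u)\<close> is an even positive function that decays
  doubly exponentially. Its Fourier transform is therefore entire and even, and the substitution
  \<open>t = e\<^sup>u\<close> in the Gamma integral identifies it with \<open>\<Lambda>\<close>. Bounding \<open>\<integral> K(u) e\<^sup>r\<^sup>|\<^sup>u\<^sup>| du\<close> from above by
  \<open>exp ((5 + r) ln (5 + r))\<close> and from below by \<open>e\<^sup>r\<close> yields the order 1.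

  The modular transformation is obtained from product formulas alone: by Liouville's theorem a theta
  function at \<open>-1/t\<close> is a multiple of the one at \<open>t\<close>, and comparing the behaviour at \<open>0\<close> with
  the product of the values at the three half periods determines the multiple.

  That the Dirichlet series converges as far as \<open>Re x > 13/2\<close> does not follow from Hecke's bound
  \<open>\<tau>(n) = O(n\<^sup>6)\<close>, but it does follow from the mean square \<open>\<Sum>\<^sub>n\<^sub>\<le>\<^sub>N \<tau>(n)\<^sup>2 = O(N\<^sup>1\<^sup>2)\<close>, a consequence of
  Parseval's identity on a horizontal line and the boundedness of \<open>|\<Delta>(t)| (Im t)\<^sup>6\<close>.
\<close>

section \<open>The \<open>q\<close>-Pochhammer product\<close>

text \<open>The infinite product \<open>(a; q)_\<infinity>\<close>. For \<open>a = q\<close> it is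
  Euler's function, whose 24th power times \<open>q\<close> is the discriminant.\<close>

definition qpoch :: "complex \<Rightarrow> complex \<Rightarrow> complex" where
  "qpoch a q = (\<Prod>n. 1 - a * q ^ n)"

lemma abs_convergent_qpoch:
  fixes a q :: complex
  assumes "norm q < 1"
  shows "abs_convergent_prod (\<lambda>n. 1 - a * q ^ n)"
proof -
  have "summable (\<lambda>n. norm a * norm q ^ n)"
    using assms by (intro summable_mult summable_geometric) auto
  thus ?thesis
    by (simp add: abs_convergent_prod_conv_summable norm_mult norm_power)
qed

lemma convergent_qpoch:
  fixes a q :: complex
  assumes "norm q < 1"
  shows "convergent_prod (\<lambda>n. 1 - a * q ^ n)"
  using abs_convergent_qpoch[OF assms] by (rule abs_convergent_prod_imp_convergent_prod)

lemma has_prod_qpoch: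
  assumes "norm q < 1"
  shows "(\<lambda>n. 1 - a * q ^ n) has_prod qpoch a q"
  unfolding qpoch_def using convergent_qpoch[OF assms] by (rule convergent_prod_has_prod)

lemma qpoch_eq_0_iff:
  assumes "norm q < 1"
  shows "qpoch a q = 0 \<longleftrightarrow> (\<exists>n. a * q ^ n = 1)"
  using has_prod_eq_0_iff[OF has_prod_qpoch[OF assms]] by (auto simp: image_iff)

lemma qpoch_tendsto:
  assumes "norm q < 1"
  shows "(\<lambda>N. \<Prod>n<N. 1 - a * q ^ n) \<longlonglongrightarrow> qpoch a q"
  unfolding qpoch_def using convergent_prod_LIMSEQ[OF convergent_qpoch[OF assms]]
  by (rule LIMSEQ_lessThan_iff_atMost[THEN iffD2])

lemma qpoch_rec:
  assumes "norm q < 1"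
  shows "qpoch a q = (1 - a) * qpoch (a * q) q"
proof -
  have "(\<lambda>n. 1 - a * q ^ n) has_prod ((\<Prod>k<1. 1 - a * q ^ k) * (\<Prod>k. 1 - a * q ^ (k + 1)))"
    by (rule has_prod_ignore_initial_segment'[OF convergent_qpoch[OF assms]])
  hence "qpoch a q = ((\<Prod>k<1. 1 - a * q ^ k) * (\<Prod>k. 1 - a * q ^ (k + 1)))"
    using has_prod_qpoch[OF assms] has_prod_unique2 by blast
  thus ?thesis by (simp add: qpoch_def mult.assoc)
qed

text \<open>Both arguments vary because \<open>qpoch q q\<close> is later studied as a function of
  \<open>q\<close>. On a compact set \<open>norm (g x)\<close> attains its maximum, which is below
  1, so a geometric series dominates and the M-test applies.\<close>

lemma uniform_limit_qpoch:
  fixes f g :: "complex \<Rightarrow> complex"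
  assumes K: "compact K" and f: "continuous_on K f" and g: "continuous_on K g"
    and lt: "\<And>x. x \<in> K \<Longrightarrow> norm (g x) < 1"
  shows "uniform_limit K (\<lambda>N x. \<Prod>n<N. 1 - f x * g x ^ n) (\<lambda>x. qpoch (f x) (g x)) sequentially"
proof -
  have "uniformly_convergent_on K (\<lambda>N x. \<Prod>n<N. 1 - f x * g x ^ n)"
  proof (cases "K = {}")
    case False
    have "bounded (f ` K)"
      using K f by (intro compact_imp_bounded compact_continuous_image)
    then obtain M where M: "\<And>x. x \<in> K \<Longrightarrow> norm (f x) \<le> M"
      by (auto simp: bounded_iff)
    obtain x0 where x0: "x0 \<in> K" "\<And>x. x \<in> K \<Longrightarrow> norm (g x) \<le> norm (g x0)"
      using continuous_attains_sup[OF K False, of "\<lambda>x. norm (g x)"] continuous_on_norm[OF g] by blast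
    show ?thesis
    proof (rule uniformly_convergent_on_prod')
      show "uniformly_convergent_on K (\<lambda>N x. \<Sum>n<N. norm (1 - f x * g x ^ n - 1))"
      proof (rule Weierstrass_m_test')
        show "norm (norm (1 - f x * g x ^ n - 1)) \<le> M * norm (g x0) ^ n" if "x \<in> K" for n x
          using M[OF that] x0(2)[OF that]
          by (auto simp: norm_mult norm_power intro!: mult_mono power_mono order_trans[OF norm_ge_zero M[OF that]])
        show "summable (\<lambda>n. M * norm (g x0) ^ n)"
          using lt[OF x0(1)] by (intro summable_mult summable_geometric) auto
      qed
    qed (use K f g in \<open>auto intro!: continuous_intros\<close>)
  qed auto
  then obtain h where h: "uniform_limit K (\<lambda>N x. \<Prod>n<N. 1 - f x * g x ^ n) h sequentially"
    by (auto simp: uniformly_convergent_on_def)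
  have "h x = qpoch (f x) (g x)" if "x \<in> K" for x
    using tendsto_uniform_limitI[OF h that] qpoch_tendsto[OF lt[OF that]] LIMSEQ_unique by blast
  with h show ?thesis
    by (metis (no_types, lifting) uniform_limit_cong')
qed

lemma holomorphic_on_qpoch [holomorphic_intros]:
  assumes "f holomorphic_on A" "g holomorphic_on A" "open A" "\<And>x. x \<in> A \<Longrightarrow> norm (g x) < 1"
  shows "(\<lambda>x. qpoch (f x) (g x)) holomorphic_on A"
proof (rule holomorphic_uniform_sequence)
  fix x assume "x \<in> A"
  then obtain d where d: "d > 0" "cball x d \<subseteq> A"
    using \<open>open A\<close> open_contains_cball by blast
  have "uniform_limit (cball x d) (\<lambda>N x. \<Prod>n<N. 1 - f x * g x ^ n) (\<lambda>x. qpoch (f x) (g x)) sequentially"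
    using d assms
    by (intro uniform_limit_qpoch holomorphic_on_imp_continuous_on)
       (auto intro: holomorphic_on_subset)
  with d show "\<exists>d>0. cball x d \<subseteq> A \<and>
      uniform_limit (cball x d) (\<lambda>N x. \<Prod>n<N. 1 - f x * g x ^ n) (\<lambda>x. qpoch (f x) (g x)) sequentially"
    by blast
qed (use assms in \<open>auto intro!: holomorphic_intros\<close>)

lemma qpoch_mult_minus:
  assumes "norm q < 1"
  shows "qpoch a q * qpoch (- a) q = qpoch (a\<^sup>2) (q\<^sup>2)"
proof -
  have "qpoch a q * qpoch (- a) q = (\<Prod>n. (1 - a * q ^ n) * (1 - (- a) * q ^ n))"
    unfolding qpoch_def by (rule prodinf_mult; rule convergent_qpoch[OF assms])
  also have "\<dots> = qpoch (a\<^sup>2) (q\<^sup>2)"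
    unfolding qpoch_def
    by (rule prodinf_cong) (simp add: algebra_simps power2_eq_square power_mult_distrib)
  finally show ?thesis .
qed

lemma qpoch_split_even_odd:
  assumes "norm q < 1"
  shows "qpoch a q = qpoch a (q\<^sup>2) * qpoch (a * q) (q\<^sup>2)"
proof -
  have q2: "norm (q\<^sup>2) < 1"
    using assms by (simp add: norm_power power_less_one_iff)
  have eq: "(\<Prod>n<2*N. 1 - a * q ^ n) = (\<Prod>n<N. 1 - a * (q\<^sup>2) ^ n) * (\<Prod>n<N. 1 - a * q * (q\<^sup>2) ^ n)" for N
    by (induction N) (simp_all add: power_mult[symmetric] mult_ac)
  have "(\<lambda>N. \<Prod>n<2*N. 1 - a * q ^ n) \<longlonglongrightarrow> qpoch a q"
    by (rule filterlim_compose[OF qpoch_tendsto[OF assms]])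
       (auto intro!: mult_nat_left_at_top)
  moreover have "(\<lambda>N. \<Prod>n<2*N. 1 - a * q ^ n) \<longlonglongrightarrow> qpoch a (q\<^sup>2) * qpoch (a * q) (q\<^sup>2)"
    unfolding eq by (intro tendsto_mult qpoch_tendsto q2)
  ultimately show ?thesis
    by (rule LIMSEQ_unique)
qed

lemma euler_phi_nonzero:
  assumes "norm q < 1"
  shows "qpoch q q \<noteq> 0"
proof
  assume "qpoch q q = 0"
  then obtain n where "q * q ^ n = 1"
    using qpoch_eq_0_iff[OF assms] by blast
  hence "norm q ^ Suc n = 1"
    by (metis norm_one norm_power power_Suc)
  moreover have "norm q ^ Suc n < 1"
    using assms by (subst power_less_one_iff) auto
  ultimately show False by simp
qed

text \<open>With \<open>q = p\<^sup>2\<close> this is Euler's identity that the product of all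
  \<open>(1 + q^n) (1 - q^(2n-1))\<close>, n \<ge> 1, is 1. Euler's function splits into odd and
  even exponents, both parts factor as differences of squares, and Euler's function reappears and
  cancels.\<close>

lemma qpoch_half_period_product:
  assumes "norm p < 1"
  shows "qpoch (- p\<^sup>2) (p\<^sup>2) * qpoch p (p\<^sup>2) * qpoch (- p) (p\<^sup>2) = 1"
proof -
  define q where "q = p\<^sup>2"
  have q: "norm q < 1" 
    unfolding q_def using assms by (simp add: norm_power power_less_one_iff)
  have "qpoch q q = qpoch q (q\<^sup>2) * qpoch (q\<^sup>2) (q\<^sup>2)"
    using qpoch_split_even_odd[OF q, of q] by (simp add: power2_eq_square)
  also have "qpoch q (q\<^sup>2) = qpoch p q * qpoch (-p) q"
    using qpoch_mult_minus[OF q, of p] by (simp add: q_def)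
  also have "qpoch (q\<^sup>2) (q\<^sup>2) = qpoch q q * qpoch (- q) q"
    using qpoch_mult_minus[OF q, of q] by simp
  finally have "qpoch q q * (qpoch (- q) q * qpoch p q * qpoch (- p) q) = qpoch q q * 1"
    by (simp add: mult_ac)
  thus ?thesis
    unfolding mult_cancel_left using euler_phi_nonzero[OF q] by (simp add: q_def)
qed


section \<open>A theta function in product form\<close>

text \<open>Fractional powers of q are values of \<open>nome\<close> at fractions of the argument,
  so that no branch of a root is ever chosen.\<close>

definition nome :: "complex \<Rightarrow> complex" where
  "nome z = exp (2 * of_real pi * \<i> * z)"

lemma nome_add: "nome (x + y) = nome x * nome y"
  by (simp add: nome_def exp_add ring_distribs)

lemma nome_minus: "nome (- x) = inverse (nome x)"
  by (simp add: nome_def exp_minus)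

lemma nome_diff: "nome (x - y) = nome x / nome y"
  by (simp add: nome_def exp_diff ring_distribs)

lemma nome_nonzero [simp]: "nome x \<noteq> 0"
  by (simp add: nome_def)

lemma nome_power: "nome x ^ n = nome (of_nat n * x)"
  by (simp add: nome_def exp_of_nat_mult[symmetric] mult_ac)

lemma nome_0 [simp]: "nome 0 = 1"
  by (simp add: nome_def)

lemma nome_quarter [simp]: "nome (1/4) = \<i>"
  using cis_pi_half by (simp add: nome_def cis_conv_exp mult_ac)

lemma nome_half [simp]: "nome (1/2) = -1"
  using nome_power[of "1/4" 2] by simp

lemma nome_1 [simp]: "nome 1 = 1"
  using nome_power[of "1/2" 2] by simp

lemma norm_nome: "norm (nome z) = exp (- 2 * pi * Im z)"
  by (simp add: nome_def)

lemma norm_nome_less_1 [simp]: "Im z > 0 \<Longrightarrow> norm (nome z) < 1"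
  by (simp add: norm_nome)

lemma nome_eq_1_iff: "nome z = 1 \<longleftrightarrow> z \<in> \<int>"
proof
  assume "nome z = 1"
  then obtain n where n: "Im z = 0" "2 * pi * Re z = of_int (2 * n) * pi"
    by (auto simp: nome_def exp_eq_1)
  hence "z = of_int n"
    by (simp add: complex_eq_iff)
  thus "z \<in> \<int>" by simp
next
  assume "z \<in> \<int>"
  then obtain n where "z = of_int n" by (elim Ints_cases)
  thus "nome z = 1"
    using exp_2pi_1_int[of n] by (simp add: nome_def mult_ac)
qed

lemma nome_holomorphic [holomorphic_intros]:
  "f holomorphic_on A \<Longrightarrow> (\<lambda>z. nome (f z)) holomorphic_on A"
  unfolding nome_def by (intro holomorphic_intros)

text \<open>
  Here \<open>half_sine z = -2 i sin (\<pi> z)\<close>, and \<open>theta\<close> is Jacobi's \<open>\<theta>\<^sub>1\<close> up to a factor independent of \<open>z\<close>.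
\<close>

definition half_sine :: "complex \<Rightarrow> complex" where
  "half_sine z = nome (- z / 2) - nome (z / 2)"

definition theta :: "complex \<Rightarrow> complex \<Rightarrow> complex" where
  "theta z t = half_sine z * qpoch (nome (t + z)) (nome t) * qpoch (nome (t - z)) (nome t)"

lemma half_sine_altdef: "half_sine z = nome (- z / 2) * (1 - nome z)"
  using nome_add[of "-z/2" z] by (simp add: half_sine_def algebra_simps)

lemma half_sine_holomorphic [holomorphic_intros]:
  "f holomorphic_on A \<Longrightarrow> (\<lambda>z. half_sine (f z)) holomorphic_on A"
  unfolding half_sine_def by (intro holomorphic_intros) auto

lemma half_sine_over_self_tendsto: "(\<lambda>z. half_sine z / z) \<midarrow>0\<rightarrow> - 2 * of_real pi * \<i>"
proof -
  have "(half_sine has_field_derivative (- 2 * of_real pi * \<i>)) (at 0)"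
    unfolding half_sine_def nome_def by (auto intro!: derivative_eq_intros)
  thus ?thesis
    by (simp add: has_field_derivative_iff half_sine_def)
qed

lemma theta_holomorphic:
  assumes "Im t > 0"
  shows "(\<lambda>z. theta z t) holomorphic_on UNIV"
  unfolding theta_def using assms by (intro holomorphic_intros) auto

lemma theta_minus: "theta (- z) t = - theta z t"
  by (simp add: theta_def half_sine_def algebra_simps)

lemma theta_plus_1: "theta (z + 1) t = - theta z t"
proof -
  have "half_sine (z + 1) = - half_sine z"
    by (simp add: half_sine_def add_divide_distrib diff_divide_distrib nome_add nome_diff)
  moreover have "nome (t + (z + 1)) = nome (t + z)" "nome (t - (z + 1)) = nome (t - z)"
    by (simp_all add: nome_add nome_diff)
  ultimately show ?thesis
    by (simp add: theta_def del: minus_diff_eq)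
qed

text \<open>The shift by \<open>t\<close> removes the first factor of one product and adds a factor
  to the other; \<open>half_sine\<close> makes up for both and leaves an exponential.\<close>

lemma theta_plus_quasiperiod:
  assumes "Im t > 0"
  shows "theta (z + t) t = - nome (- t / 2 - z) * theta z t"
proof -
  have q: "norm (nome t) < 1" using assms by simp
  have "qpoch (nome (t + z)) (nome t) = (1 - nome (t + z)) * qpoch (nome (t + (z + t))) (nome t)"
    by (subst qpoch_rec[OF q]) (simp add: nome_add[symmetric] add_ac)
  moreover have "qpoch (nome (t - (z + t))) (nome t) = (1 - nome (-z)) * qpoch (nome (t - z)) (nome t)"
    by (subst qpoch_rec[OF q]) (simp add: nome_add nome_diff nome_minus field_simps)
  moreover have "half_sine (z + t) = nome (- t / 2 - z) * nome (z / 2) * (1 - nome (t + z))"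
    using nome_add[of "- t / 2 - z" "z / 2"]
    by (simp add: half_sine_altdef add.commute diff_divide_distrib[symmetric] field_simps)
  moreover have "half_sine z = - nome (z / 2) * (1 - nome (- z))"
    using nome_add[of "z/2" "-z"] by (simp add: half_sine_def algebra_simps)
  ultimately show ?thesis
    by (simp add: theta_def)
qed

text \<open>Confines the possible singularities of a quotient by \<open>theta\<close> to lattice
  points: a factor vanishes only if some \<open>k * t + z\<close> or \<open>k * t - z\<close> is an
  integer.\<close>

lemma theta_zeroD:
  assumes "Im t > 0" "theta z t = 0"
  obtains m n :: int where "z = of_int m + of_int n * t"
proof -
  have q: "norm (nome t) < 1" using assms by simp
  have *: "\<exists>m n. z = of_int m + of_int n * t" if k: "nome (of_int k * t + s * z) = 1" and s: "s \<in> {1, -1}" for k s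
  proof -
    obtain j where "of_int k * t + s * z = of_int j"
      using k unfolding nome_eq_1_iff by (elim Ints_cases)
    with s have "z = of_int j + of_int (-k) * t \<or> z = of_int (-j) + of_int k * t"
      by (auto simp: algebra_simps add_eq_0_iff) 
    thus ?thesis by blast
  qed
  from assms(2) consider "nome z = 1" | n where "nome (t + z) * nome t ^ n = 1"
    | n where "nome (t - z) * nome t ^ n = 1"
    by (auto simp: theta_def half_sine_altdef qpoch_eq_0_iff[OF q])
  hence "\<exists>m n. z = of_int m + of_int n * t"
  proof cases
    case 1
    thus ?thesis using *[of 0 1] by simp
  next
    case (2 n)
    thus ?thesis using *[of "int n + 1" 1]
      by (simp add: nome_power nome_add[symmetric] algebra_simps)
  next
    case (3 n)
    thus ?thesis using *[of "int n + 1" "-1"]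
      by (simp add: nome_power nome_add[symmetric] algebra_simps)
  qed
  thus thesis using that by blast
qed

text \<open>Up to an elementary factor, each half-period value is the square of one of the three
  products whose product is 1 by \<open>qpoch_half_period_product\<close>.\<close>

lemma theta_half_period_product:
  assumes "Im t > 0"
  shows "theta (1/2) t * theta (t/2) t * theta ((1 + t) / 2) t = - 2 * nome (- t / 2)"
proof -
  define p where "p = nome (t / 2)"
  have p: "norm p < 1" unfolding p_def using assms by simp
  have pq: "nome t = p\<^sup>2" by (simp add: p_def nome_power)
  have p2: "norm (p\<^sup>2) < 1" using p by (simp add: norm_power power_less_one_iff)
  have h: "nome (- t / 4) * nome (- t / 4) = inverse p"
    by (simp add: p_def nome_add[symmetric] nome_minus[symmetric])
  have p4: "nome (t / 4) = nome (-t / 4) * p"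
    by (simp add: p_def nome_add[symmetric])
  have m4: "nome (- 1 / 4) = - \<i>"
    using nome_minus[of "1/4"] by simp
  have m4': "nome (- (1 / 4)) = - \<i>"
    using nome_minus[of "1/4"] by simp
  have "theta (1/2) t = - 2 * \<i> * (qpoch (- p\<^sup>2) (p\<^sup>2))\<^sup>2"
    by (simp add: theta_def half_sine_def pq nome_add nome_diff m4' power2_eq_square)
  moreover have "theta (t/2) t = nome (- t / 4) * (qpoch p (p\<^sup>2))\<^sup>2"
  proof -
    \<comment> \<open>The first product starts only at \<open>p * p\<^sup>2\<close>; the factor
      \<open>1 - p\<close> that it lacks comes from \<open>half_sine\<close>. At
      \<open>(1 + t) / 2\<close> the same happens with \<open>- p\<close> in place of
      \<open>p\<close>.\<close>
    have *: "t + t / 2 = t / 2 + t" "t - t / 2 = t / 2" by simp_all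
    have "theta (t/2) t = nome (- t / 4) * (1 - p) * qpoch (p * p\<^sup>2) (p\<^sup>2) * qpoch p (p\<^sup>2)"
      unfolding theta_def * half_sine_altdef nome_add[of "t/2" t] by (simp add: pq p_def[symmetric])
    thus ?thesis
      using qpoch_rec[OF p2, of p] by (simp add: power2_eq_square)
  qed
  moreover have "theta ((1 + t)/2) t = - \<i> * nome (- t / 4) * (qpoch (- p) (p\<^sup>2))\<^sup>2"
  proof -
    have *: "t + (1 + t) / 2 = 1 / 2 + t / 2 + t" "t - (1 + t) / 2 = t / 2 - 1 / 2"
      by (simp_all add: field_simps)
    have "half_sine ((1 + t)/2) = - \<i> * nome (- t / 4) * (1 + p)"
    proof -
      have "- ((1 + t) / 2) / 2 = - 1 / 4 + - t / 4" "(1 + t) / 2 / 2 = 1 / 4 + t / 4"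
        by (simp_all add: field_simps)
      thus ?thesis
        unfolding half_sine_def by (simp only: nome_add p4 m4 nome_quarter) (simp add: algebra_simps)
    qed
    hence "theta ((1 + t)/2) t = - \<i> * nome (- t / 4) * (1 + p) * qpoch (- p * p\<^sup>2) (p\<^sup>2) * qpoch (- p) (p\<^sup>2)"
      unfolding theta_def * nome_add[of "_ + _" t] nome_add[of "1/2" "t/2"] nome_diff
      by (simp add: pq p_def[symmetric])
    thus ?thesis
      using qpoch_rec[OF p2, of "-p"] by (simp add: power2_eq_square)
  qed
  moreover have "(- 2 * \<i> * A\<^sup>2) * (n * B\<^sup>2) * (- \<i> * n * C\<^sup>2) = - 2 * (n * n) * (A * B * C)\<^sup>2" for A B C n
    using power2_i by algebra
  ultimately have "theta (1/2) t * theta (t/2) t * theta ((1 + t) / 2) t =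
      - 2 * (nome (- t / 4) * nome (- t / 4)) * (qpoch (- p\<^sup>2) (p\<^sup>2) * qpoch p (p\<^sup>2) * qpoch (- p) (p\<^sup>2))\<^sup>2"
    by (simp only:)
  also have "\<dots> = - 2 * nome (- t / 2)"
    unfolding qpoch_half_period_product[OF p] h by (simp add: p_def nome_minus)
  finally show ?thesis .
qed

section \<open>Doubly periodic entire functions\<close>

lemma doubly_periodic_lattice_shift:
  fixes h :: "complex \<Rightarrow> complex"
  assumes p1: "\<And>z. h (z + 1) = h z" and pt: "\<And>z. h (z + t) = h z"
  shows "h (z + of_int m + of_int n * t) = h z"
proof -
  have n1: "h (z + of_nat n) = h z" for z n
  proof (induction n)
    case (Suc n)
    thus ?case using p1[of "z + of_nat n"] by (simp add: add_ac)
  qed auto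
  have nt: "h (z + of_nat n * t) = h z" for z n
  proof (induction n)
    case (Suc n)
    thus ?case using pt[of "z + of_nat n * t"] by (simp add: algebra_simps)
  qed auto
  have i1: "h (z + of_int n) = h z" for z n
    using n1[of z "nat n"] n1[of "z + of_int n" "nat (-n)"] by (cases "n \<ge> 0") auto
  have it: "h (z + of_int n * t) = h z" for z n
    using nt[of z "nat n"] nt[of "z + of_int n * t" "nat (-n)"] by (cases "n \<ge> 0") auto
  show ?thesis
    by (simp only: it i1)
qed

text \<open>In the real basis \<open>1\<close>, \<open>t\<close> every point can be reduced to
  fractional coordinates, so all values are taken on a compact period parallelogram and Liouville's
  theorem applies.\<close>

lemma doubly_periodic_entire_const:
  assumes h: "h holomorphic_on UNIV" and t: "Im t > 0"
    and p1: "\<And>z. h (z + 1) = h z" and pt: "\<And>z. h (z + t) = h z"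
  shows "h z = h w"
proof -
  define K where "K = (\<lambda>(x, y). of_real x + of_real y * t) ` ({0..1::real} \<times> {0..1::real})"
  have "compact K"
    unfolding K_def by (intro compact_continuous_image compact_Times)
      (auto intro!: continuous_intros simp: case_prod_unfold)
  hence "bounded (h ` K)"
    using h by (intro compact_imp_bounded compact_continuous_image)
      (auto intro: holomorphic_on_imp_continuous_on holomorphic_on_subset)
  have "h z \<in> h ` K" for z
  proof -
    define y where "y = Im z / Im t"
    define x where "x = Re (z - of_real y * t)"
    have z: "z = of_real x + of_real y * t"
      using t by (simp add: x_def y_def complex_eq_iff)
    have "h z = h (of_real (frac x) + of_real (frac y) * t + of_int \<lfloor>x\<rfloor> + of_int \<lfloor>y\<rfloor> * t)"
      by (subst z) (simp add: frac_def algebra_simps)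
    also have "\<dots> = h (of_real (frac x) + of_real (frac y) * t)"
      by (rule doubly_periodic_lattice_shift[of h, OF p1 pt])
    finally show ?thesis
      unfolding K_def by (auto intro!: image_eqI[of _ _ "(frac x, frac y)"] less_imp_le frac_lt_1 imageI)
  qed
  hence "range h \<subseteq> h ` K" by blast
  with \<open>bounded (h ` K)\<close> have "h constant_on UNIV"
    using Liouville_theorem h bounded_subset by blast
  thus ?thesis by (auto simp: constant_on_def)
qed


section \<open>The modular transformation of the discriminant\<close>

text \<open>The modular discriminant normalized to leading coefficient 1, that is, the 24th power of
  Dedekind's \<eta>.\<close>

definition discr :: "complex \<Rightarrow> complex" where
  "discr t = nome t * qpoch (nome t) (nome t) ^ 24"

lemma Im_minus_inverse: "Im (-1/t) = Im t / (norm t)\<^sup>2"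
  by (simp add: Im_divide cmod_power2)

lemma Im_minus_inverse_pos: "Im t > 0 \<Longrightarrow> Im (-1/t) > 0"
  unfolding Im_minus_inverse by (auto intro!: divide_pos_pos)

text \<open>
  The quotient of the two sides is entire and doubly periodic; the constant \<open>c\<close> is its value at \<open>0\<close>.
\<close>

lemma theta_inversion:
  assumes t: "Im t > 0"
  defines "c \<equiv> (qpoch (nome (-1/t)) (nome (-1/t)) / qpoch (nome t) (nome t))\<^sup>2 / t"
  assumes z: "theta z t \<noteq> 0"
  shows "nome (- z\<^sup>2 / (2 * t)) * theta (z / t) (-1/t) = c * theta z t"
proof -
  have t0: "t \<noteq> 0" using t by auto
  define t' where "t' = -1/t"
  have t': "Im t' > 0"
    unfolding t'_def by (rule Im_minus_inverse_pos[OF t])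
  define A where "A = (\<lambda>z. nome (- z\<^sup>2 / (2 * t)) * theta (z / t) t')"
  define B where "B = (\<lambda>z. theta z t)"
  define g where "g = (\<lambda>z. A z / B z)"
  have "(\<lambda>z. z / t) holomorphic_on UNIV"
    using t0 by (intro holomorphic_intros) auto
  hence "(\<lambda>z. theta (z / t) t') holomorphic_on UNIV"
    by (rule holomorphic_on_compose_gen[OF _ theta_holomorphic[OF t'], unfolded o_def]) auto
  hence A_hol: "A holomorphic_on UNIV"
    unfolding A_def by (intro holomorphic_intros) (use t0 in auto)
  have B_hol: "B holomorphic_on UNIV"
    unfolding B_def by (rule theta_holomorphic[OF t])
  \<comment> \<open>In the variable \<open>z / t\<close> a shift of \<open>z\<close> by 1 is a shift
    by \<open>- t'\<close>, and the Gaussian factor absorbs the resulting multiplier. In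
    \<open>At\<close> the roles are exchanged: there the sign comes from \<open>theta\<close> and
    the multiplier from the Gaussian.\<close>
  have A1: "A (z + 1) = - A z" for z
  proof -
    have "theta (z / t) t' = - nome (t' / 2 - z / t) * theta (z / t - t') t'"
      using theta_plus_quasiperiod[OF t', of "z / t - t'"] by (simp add: algebra_simps)
    moreover have "nome (t' / 2 - z / t) * nome (z / t - t' / 2) = 1"
      by (simp add: nome_add[symmetric])
    ultimately have "theta (z / t - t') t' = - nome (z / t - t' / 2) * theta (z / t) t'"
      by (simp add: field_simps)
    moreover have "- (z + 1)\<^sup>2 / (2 * t) + (z / t - t' / 2) = - z\<^sup>2 / (2 * t)"
      using t0 by (simp add: t'_def field_simps power2_eq_square)
    hence "nome (- z\<^sup>2 / (2 * t)) = nome (- (z + 1)\<^sup>2 / (2 * t)) * nome (z / t - t' / 2)"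
      by (simp only: nome_add[symmetric])
    moreover have "(z + 1) / t = z / t - t'"
      by (simp add: t'_def add_divide_distrib)
    ultimately show ?thesis
      unfolding A_def by simp
  qed
  have At: "A (z + t) = - nome (- t / 2 - z) * A z" for z
  proof -
    have "theta ((z + t) / t) t' = - theta (z / t) t'"
      using theta_plus_1[of "z/t"] t0 by (simp add: add_divide_distrib)
    moreover have "- (z + t)\<^sup>2 / (2 * t) = (- t / 2 - z) + (- z\<^sup>2 / (2 * t))"
      using t0 by (simp add: field_simps power2_eq_square)
    ultimately show ?thesis
      unfolding A_def by (simp only: nome_add) simp
  qed
  have g1: "g (z + 1) = g z" for z
    by (simp add: g_def A1 B_def theta_plus_1)
  have gt: "g (z + t) = g z" for z
    using theta_plus_quasiperiod[OF t, of z] by (simp add: g_def At B_def)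
  \<comment> \<open>Both \<open>half_sine\<close> factors vanish at 0. Dividing each by its own
    argument leaves quotients with the same nonzero limit and the extra factor
    \<open>1 / t\<close>.\<close>
  have g0: "g \<midarrow>0\<rightarrow> c"
  proof -
    define Q where "Q = (\<lambda>t z. qpoch (nome (t + z)) (nome t) * qpoch (nome (t - z)) (nome t))"
    have Q: "isCont (Q t) 0" if "Im t > 0" for t
    proof -
      have "Q t holomorphic_on UNIV"
        unfolding Q_def using that by (intro holomorphic_intros) auto
      thus ?thesis
        by (intro analytic_at_imp_isCont) (simp add: holomorphic_on_imp_analytic_at)
    qed
    let ?d = "- 2 * of_real pi * \<i> :: complex"
    have "filterlim (\<lambda>z. z / t) (at 0) (at 0)"
      using t0 by (auto simp: filterlim_at eventually_at_filter intro!: tendsto_eq_intros)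
    hence "((\<lambda>z. half_sine (z / t) / (z / t)) \<longlongrightarrow> ?d) (at 0)"
      using filterlim_compose[OF half_sine_over_self_tendsto] by blast
    hence "((\<lambda>z. (half_sine (z / t) / (z / t)) / (half_sine z / z) / t) \<longlongrightarrow> ?d / ?d / t) (at 0)"
      by (intro tendsto_intros half_sine_over_self_tendsto t0) auto
    moreover have "((\<lambda>z. Q t' (z / t)) \<longlongrightarrow> Q t' 0) (at 0)"
    proof (rule isCont_tendsto_compose[where g = "Q t'", OF Q[OF t']])
      show "((\<lambda>z. z / t) \<longlongrightarrow> 0) (at 0)"
        using t0 by (auto intro!: tendsto_eq_intros)
    qed
    moreover have "((\<lambda>z. nome (- z\<^sup>2 / (2 * t))) \<longlongrightarrow> 1) (at 0)"
      unfolding nome_def using t0 by (auto intro!: tendsto_eq_intros)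
    moreover have "Q t 0 \<noteq> 0"
      using euler_phi_nonzero[of "nome t"] t by (simp add: Q_def)
    ultimately have "((\<lambda>z. nome (- z\<^sup>2 / (2 * t)) * ((half_sine (z / t) / (z / t)) / (half_sine z / z) / t)
        * (Q t' (z / t) / Q t z)) \<longlongrightarrow> 1 * (?d / ?d / t) * (Q t' 0 / Q t 0)) (at 0)"
      using Q[OF t] unfolding isCont_def by - (assumption | rule tendsto_mult tendsto_divide)+
    moreover have "1 * (?d / ?d / t) * (Q t' 0 / Q t 0) = c"
      by (simp add: c_def t'_def Q_def power2_eq_square)
    moreover have "eventually (\<lambda>z. nome (- z\<^sup>2 / (2 * t)) * ((half_sine (z / t) / (z / t)) / (half_sine z / z) / t)
        * (Q t' (z / t) / Q t z) = g z) (at 0)"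
      unfolding eventually_at_filter using t0
      by (auto simp: g_def A_def B_def theta_def Q_def field_simps)
    ultimately show ?thesis
      using Lim_transform_eventually by force
  qed
  \<comment> \<open>Every singularity is removable: a zero of \<open>B\<close> is a lattice point,
    to which periodicity carries the limit at 0.\<close>
  have lim: "\<exists>c. g \<midarrow>w\<rightarrow> c" for w
  proof (cases "B w = 0")
    case True
    then obtain m n :: int where w: "w = of_int m + of_int n * t"
      using theta_zeroD[OF t, of w] unfolding B_def by blast
    have "(\<lambda>x. g (x + (- w))) \<midarrow>0 - (-w)\<rightarrow> c"
      by (rule LIM_offset[OF g0])
    moreover have "g (x + (- w)) = g x" for x
      using doubly_periodic_lattice_shift[of g, OF g1 gt, of "x - w" m n] by (simp add: w algebra_simps)
    ultimately show ?thesis by auto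
  next
    case False
    have "A analytic_on {w}" "B analytic_on {w}"
      using A_hol B_hol by (auto intro: holomorphic_on_imp_analytic_at)
    hence "isCont g w"
      unfolding g_def using False by (intro continuous_divide analytic_at_imp_isCont) auto
    thus ?thesis by (auto simp: isCont_def)
  qed
  have "g meromorphic_on UNIV"
    unfolding g_def using A_hol B_hol
    by (intro meromorphic_intros analytic_on_imp_meromorphic_on)
       (auto simp: analytic_on_open)
  hence iso: "isolated_singularity_at g w" for w
    using meromorphic_on_isolated_singularity meromorphic_on_subset by blast
  define h where "h = remove_sings g"
  have "h analytic_on {w}" for w
    unfolding h_def using remove_sings_analytic_at[OF iso] lim by blast
  hence "h analytic_on UNIV"
    using analytic_on_analytic_at by blast
  hence h_hol: "h holomorphic_on UNIV"
    by (rule analytic_imp_holomorphic)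
  \<comment> \<open>Removing singularities commutes with translations, so \<open>h\<close> inherits
    both periods of \<open>g\<close>.\<close>
  have shift: "h (w + d) = h w" if "\<And>w. g (w + d) = g w" for w d
  proof -
    have "remove_sings (g \<circ> (\<lambda>w. w + d)) w = remove_sings g (w + d)"
      by (rule remove_sings_compose) (use filtermap_at_shift[of "-d" w] in simp)
    thus ?thesis using that by (simp add: o_def h_def)
  qed
  have "h z = h 0"
    using doubly_periodic_entire_const[OF h_hol t] shift[OF g1] shift[OF gt] by blast
  also have "h 0 = c"
    unfolding h_def using g0 by blast
  finally have "h z = c" .
  moreover have "h z = g z"
  proof -
    have "A analytic_on {z}" "B analytic_on {z}"
      using A_hol B_hol by (auto intro: holomorphic_on_imp_analytic_at)
    hence "g analytic_on {z}"
      unfolding g_def using z by (intro analytic_on_divide) (auto simp: B_def)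
    thus ?thesis unfolding h_def by simp
  qed
  ultimately show ?thesis
    using z by (simp add: g_def A_def B_def t'_def field_simps)
qed

text \<open>
  The product of \<open>theta\<close> over the three half periods is elementary, so multiplying the inversion
  formula at these points determines \<open>c\<^sup>3\<close>, whereas \<open>c\<close> itself is a quotient of Euler products.
\<close>

lemma discr_inversion:
  assumes t: "Im t > 0"
  shows "discr (-1/t) = t ^ 12 * discr t"
proof -
  have t0: "t \<noteq> 0" using t by auto
  define t' where "t' = -1/t"
  have t': "Im t' > 0"
    unfolding t'_def by (rule Im_minus_inverse_pos[OF t])
  define \<phi> where "\<phi> = (\<lambda>t. qpoch (nome t) (nome t))"
  define c where "c = (\<phi> t' / \<phi> t)\<^sup>2 / t"
  define E where "E = (\<lambda>z. nome (- z\<^sup>2 / (2 * t)))"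
  have \<phi>0: "\<phi> t \<noteq> 0"
    unfolding \<phi>_def using t by (intro euler_phi_nonzero) simp
  have prod: "theta (1/2) t * theta (t/2) t * theta ((1 + t) / 2) t = - 2 * nome (- t / 2)"
    by (rule theta_half_period_product[OF t])
  have prod': "theta (1/2) t' * theta (t'/2) t' * theta ((1 + t') / 2) t' = - 2 * nome (- t' / 2)"
    by (rule theta_half_period_product[OF t'])
  have nz: "theta (1/2) t \<noteq> 0" "theta (t/2) t \<noteq> 0" "theta ((1 + t) / 2) t \<noteq> 0"
    using prod by auto
  note inv = theta_inversion[OF t, folded t'_def, folded \<phi>_def[THEN fun_cong], folded c_def E_def[THEN fun_cong]]
  \<comment> \<open>Division by \<open>t\<close> permutes the half periods up to sign and lattice
    shifts: \<open>1/2\<close> goes to \<open>- t'/2\<close>, \<open>t/2\<close> to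
    \<open>1/2\<close>, and \<open>(1 + t)/2\<close> to \<open>(1 - t')/2\<close>.\<close>
  have i1: "- E (1/2) * theta (t'/2) t' = c * theta (1/2) t"
  proof -
    have "1/2/t = - (t'/2)" by (simp add: t'_def)
    hence "E (1/2) * theta (- (t'/2)) t' = c * theta (1/2) t"
      using inv[OF nz(1)] by (simp only:)
    thus ?thesis unfolding theta_minus by simp
  qed
  have i2: "E (t/2) * theta (1/2) t' = c * theta (t/2) t"
    using inv[OF nz(2)] t0 by simp
  have i3: "E ((1 + t)/2) * theta ((1 + t')/2) t' = c * theta ((1 + t)/2) t"
  proof -
    have "(1 + t)/2/t = - ((t' - 1) / 2)"
      using t0 by (simp add: t'_def field_simps)
    hence "theta ((1 + t)/2/t) t' = theta (- ((t' - 1) / 2)) t'"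
      by (simp only:)
    also have "\<dots> = theta ((t' - 1) / 2 + 1) t'"
      by (simp only: theta_minus theta_plus_1)
    also have "(t' - 1) / 2 + 1 = (1 + t') / 2"
      by (simp add: field_simps)
    finally show ?thesis using inv[OF nz(3)] by simp
  qed
  have "E (1/2) * E (t/2) * E ((1+t)/2) * nome (- t' / 2) = nome (1 / (4 * t) - t / 4 - 1 / 4)"
  proof -
    have "- (1/2)\<^sup>2 / (2 * t) + - (t/2)\<^sup>2 / (2 * t) + - ((1+t)/2)\<^sup>2 / (2 * t) + - t' / 2
        = 1 / (4 * t) - t / 4 - 1 / 4"
      using t0 by (simp add: t'_def field_simps power2_eq_square)
    thus ?thesis unfolding E_def by (simp only: nome_add[symmetric])
  qed
  hence "2 * nome (1 / (4 * t) - t / 4 - 1 / 4)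
      = - (E (1/2) * E (t/2) * E ((1+t)/2)) * (- 2 * nome (- t' / 2))"
    by (simp add: mult_ac)
  also have "\<dots> = (- E (1/2) * theta (t'/2) t') * (E (t/2) * theta (1/2) t') * (E ((1 + t)/2) * theta ((1 + t')/2) t')"
    unfolding prod'[symmetric] by (simp only: mult_ac mult_minus_left mult_minus_right)
  also have "\<dots> = (c * theta (1/2) t) * (c * theta (t/2) t) * (c * theta ((1 + t) / 2) t)"
    by (simp only: i1 i2 i3)
  also have "\<dots> = c ^ 3 * (theta (1/2) t * theta (t/2) t * theta ((1 + t) / 2) t)"
    by (simp only: power3_eq_cube mult_ac)
  finally have "c ^ 3 * (- 2 * nome (- t / 2)) = 2 * nome (1 / (4 * t) - t / 4 - 1 / 4)"
    by (simp only: prod)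
  moreover have "x = - (z / y)" if "x * (- 2 * y) = 2 * z" "y \<noteq> 0" for x y z :: complex
    using that by (auto simp: field_simps)
  ultimately have "c ^ 3 = - (nome (1 / (4 * t) - t / 4 - 1 / 4) / nome (- t / 2))"
    using nome_nonzero by blast
  also have "\<dots> = - nome (1 / (4 * t) - t / 4 - 1 / 4 - (- t / 2))"
    by (simp only: nome_diff)
  \<comment> \<open>The fourth power turns \<open>c ^ 3\<close> into \<open>c ^ 12\<close>, hence
    into 24th powers of Euler's function, and clears both the sign and the quarters in the
    exponent.\<close>
  finally have "(c ^ 3) ^ 4 = nome (1 / (4 * t) - t / 4 - 1 / 4 - (- t / 2)) ^ 4"
    by simp
  also have "\<dots> = nome (t - t' - 1)"
  proof -
    have "of_nat 4 * (1 / (4 * t) - t / 4 - 1 / 4 - (- t / 2)) = t - t' - 1"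
      using t0 by (simp add: t'_def field_simps)
    thus ?thesis unfolding nome_power by (simp only:)
  qed
  also have "\<dots> = nome t / nome t'"
    by (simp add: nome_diff)
  finally have "(\<phi> t' / \<phi> t) ^ 24 / t ^ 12 = nome t / nome t'"
    by (simp add: c_def power_divide power_mult_distrib flip: power_mult)
  thus ?thesis
    using \<phi>0 t0 unfolding discr_def t'_def[symmetric] \<phi>_def[THEN fun_cong, symmetric]
    by (simp add: field_simps)
qed

section \<open>Size of the discriminant in the upper half-plane\<close>

lemma discr_decay:
  obtains M where "M > 0" "\<And>t. Im t \<ge> 1/2 \<Longrightarrow> norm (discr t) \<le> M * exp (- 2 * pi * Im t)"
proof -
  have "(\<lambda>q. qpoch q q) holomorphic_on ball 0 1"
    by (intro holomorphic_intros) auto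
  hence "continuous_on (cball 0 (exp (- pi))) (\<lambda>q. qpoch q q)"
    by (rule holomorphic_on_imp_continuous_on[OF holomorphic_on_subset])
      (auto simp: subset_iff intro: order.strict_trans1[of _ "exp (- pi)" 1])
  hence "bounded ((\<lambda>q. qpoch q q) ` cball 0 (exp (- pi)))"
    by (intro compact_imp_bounded compact_continuous_image) auto
  then obtain M where M: "M > 0" "\<And>q. norm q \<le> exp (- pi) \<Longrightarrow> norm (qpoch q q) \<le> M"
    by (auto simp: bounded_pos)
  show thesis
  proof (rule that[of "M ^ 24"])
    fix t assume t: "Im t \<ge> 1/2"
    \<comment> \<open>Thus \<open>nome t\<close> stays in a compact disc inside the unit disc, where
      Euler's function is bounded; the leading factor \<open>nome t\<close> alone gives the
      decay.\<close>
    have "norm (nome t) \<le> exp (- pi)"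
      using t by (simp add: norm_nome)
    hence "norm (qpoch (nome t) (nome t)) ^ 24 \<le> M ^ 24"
      using M by (intro power_mono) auto
    thus "norm (discr t) \<le> M ^ 24 * exp (- 2 * pi * Im t)"
      by (simp add: discr_def norm_mult norm_power norm_nome)
  qed (use M in auto)
qed

lemma discr_plus_int: "discr (t + of_int n) = discr t"
proof -
  have "nome (of_int n) = 1"
    by (simp add: nome_eq_1_iff)
  thus ?thesis by (simp add: discr_def nome_add)
qed

text \<open>
  \<open>|\<Delta>(t)| (Im t)\<^sup>6\<close> is invariant under \<open>t \<mapsto> t + 1\<close> and \<open>t \<mapsto> -1/t\<close>, and below height \<open>1/2\<close> these
  moves can be used to double the imaginary part.
\<close>

lemma discr_weight_bound:
  obtains C where "C > 0" "\<And>t. Im t > 0 \<Longrightarrow> norm (discr t) * Im t ^ 6 \<le> C"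
proof -
  obtain M where M: "M > 0" "\<And>t. Im t \<ge> 1/2 \<Longrightarrow> norm (discr t) \<le> M * exp (- 2 * pi * Im t)"
    by (rule discr_decay) blast
  \<comment> \<open>The factor \<open>6 ^ 6\<close> stems from the sixth power of
    \<open>y / 6 \<le> exp (y / 6)\<close>; the remaining \<open>exp y\<close> is beaten by the
    decay of \<open>discr\<close>.\<close>
  define C where "C = M * 6 ^ 6"
  have base: "norm (discr t) * Im t ^ 6 \<le> C" if t: "Im t \<ge> 1/2" for t
  proof -
    have "Im t / 6 \<le> exp (Im t / 6)"
      using exp_ge_add_one_self[of "Im t / 6"] by linarith
    hence "(Im t / 6) ^ 6 \<le> exp (Im t / 6) ^ 6"
      using t by (intro power_mono) auto
    also have "\<dots> = exp (Im t)"
      by (simp add: exp_of_nat_mult[symmetric])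
    finally have *: "Im t ^ 6 \<le> 6 ^ 6 * exp (Im t)"
      by (simp add: power_divide)
    have "norm (discr t) * Im t ^ 6 \<le> (M * exp (- 2 * pi * Im t)) * (6 ^ 6 * exp (Im t))"
      using M t by (intro mult_mono *) auto
    also have "\<dots> = C * exp (Im t - 2 * pi * Im t)"
      by (simp add: C_def exp_diff exp_minus field_simps)
    also have "Im t - 2 * pi * Im t \<le> 0"
      using t pi_ge_two by simp
    hence "C * exp (Im t - 2 * pi * Im t) \<le> C * 1"
      using M by (intro mult_left_mono) (auto simp: C_def)
    finally show ?thesis by simp
  qed
  have "norm (discr t) * Im t ^ 6 \<le> C" if "Im t \<ge> 1 / 2 ^ Suc n" for t n
    using that
  proof (induction n arbitrary: t)
    case 0
    thus ?case using base by simp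
  next
    case (Suc n)
    show ?case
    proof (cases "Im t \<ge> 1 / 2")
      case False
      \<comment> \<open>Rounding gives \<bar>Re u\<bar> \<le> 1/2, and Im u \<le> 1/2 as well. Hence
        the squared modulus is at most 1/2 and inversion at least doubles the imaginary
        part.\<close>
      define u where "u = t + of_int (- round (Re t))"
      have y: "Im u = Im t" "Im t > 0" "Im t \<le> 1/2"
        using False Suc.prems by (auto simp: u_def intro: less_le_trans[OF _ Suc.prems])
      have "\<bar>Re u\<bar> \<le> 1 / 2"
        using of_int_round_abs_le[of "Re t"] by (simp add: u_def abs_minus_commute)
      hence "(Re u)\<^sup>2 \<le> (1/2)\<^sup>2" "(Im u)\<^sup>2 \<le> (1/2)\<^sup>2"
        using y by (auto intro!: power_mono simp flip: abs_le_square_iff)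
      hence n: "(norm u)\<^sup>2 \<le> 1/2"
        unfolding cmod_power2 by (simp add: power_divide)
      have u0: "norm u > 0" using y by auto
      have "1 / 2 ^ Suc n \<le> 2 * Im u"
        using Suc.prems y by simp
      also have "\<dots> \<le> Im u / (norm u)\<^sup>2"
        using n u0 y mult_left_mono[OF n, of "2 * Im u"] by (simp add: field_simps)
      also have "\<dots> = Im (-1/u)"
        by (rule Im_minus_inverse[symmetric])
      finally have "norm (discr (-1/u)) * Im (-1/u) ^ 6 \<le> C"
        by (rule Suc.IH)
      also have "norm (discr (-1/u)) * Im (-1/u) ^ 6 = norm (discr u) * Im u ^ 6"
        unfolding Im_minus_inverse using u0 y
        by (subst discr_inversion) (auto simp: norm_mult norm_power power_divide simp flip: power_mult)
      finally show ?thesis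
        using y by (simp add: u_def discr_plus_int del: of_int_minus)
    qed (use base in auto)
  qed
  moreover have "\<exists>n. 1 / 2 ^ Suc n \<le> y" if "y > 0" for y :: real
  proof -
    obtain n where "(1/2) ^ n < y"
      using real_arch_pow_inv[OF \<open>y > 0\<close>, of "1/2"] by auto
    hence "1 / 2 ^ Suc n \<le> y"
      using that by (simp add: power_one_over field_simps)
    thus ?thesis by blast
  qed
  moreover have "C > 0"
    using M by (simp add: C_def)
  ultimately show thesis
    using that[of C] by blast
qed


section \<open>The coefficients of the discriminant\<close>

lemma fps_mult_unit_upto:
  fixes A B :: "'a :: comm_ring_1 fps"
  assumes "\<And>j. j \<le> k \<Longrightarrow> fps_nth B j = fps_nth 1 j" "m \<le> k"
  shows "fps_nth (A * B) m = fps_nth A m"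
proof -
  have "fps_nth (A * B) m = (\<Sum>i=0..m. fps_nth A i * fps_nth B (m - i))"
    by (rule fps_mult_nth)
  also have "\<dots> = (\<Sum>i=0..m. fps_nth A i * fps_nth 1 (m - i))"
    using assms by (intro sum.cong) auto
  also have "\<dots> = fps_nth (A * 1) m"
    by (simp only: fps_mult_nth)
  finally show ?thesis by simp
qed

lemma fps_euler_factor_nth:
  fixes l :: nat
  assumes "j \<le> k"
  shows "fps_nth ((1 - fps_X ^ Suc k :: 'a :: comm_ring_1 fps) ^ l) j = fps_nth 1 j"
proof (induction l)
  case (Suc l)
  have "fps_nth ((1 - fps_X ^ Suc k) ^ l * (1 - fps_X ^ Suc k :: 'a fps)) j = fps_nth ((1 - fps_X ^ Suc k) ^ l) j"
    by (rule fps_mult_unit_upto[of k]) (use assms in \<open>auto simp: fps_X_power_nth simp del: power_Suc\<close>)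
  thus ?case using Suc.IH by (simp add: mult.commute)
qed auto

text \<open>Polymorphic in the coefficients: the integer version computes
  \<open>ramanujan_tau\<close>, while the complex one is compared with a holomorphic
  function.\<close>

definition euler_partial :: "nat \<Rightarrow> 'a :: comm_ring_1 fps" where
  "euler_partial N = (\<Prod>n<N. (1 - fps_X ^ Suc n) ^ 24)"

text \<open>The factor with index \<open>N\<close> agrees with 1 in all coefficients up to
  \<open>N\<close>, so appending it leaves these coefficients of the product alone.\<close>

lemma euler_partial_stable: "m \<le> N \<Longrightarrow> fps_nth (euler_partial N) m = fps_nth (euler_partial m) m"
proof (induction N rule: dec_induct)
  case (step N)
  have "euler_partial (Suc N) = euler_partial N * (1 - fps_X ^ Suc N) ^ 24"
    unfolding euler_partial_def by simp
  thus ?case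
    using fps_mult_unit_upto[OF fps_euler_factor_nth step(1)] step(3) by metis
qed auto

lemma euler_partial_of_int:
  "fps_nth (euler_partial N :: complex fps) m = of_int (fps_nth (euler_partial N) m)"
proof -
  define R where "R = (\<lambda>(A :: complex fps) (B :: int fps). \<forall>m. fps_nth A m = of_int (fps_nth B m))"
  have mult: "R (A * A') (B * B')" if "R A B" "R A' B'" for A A' B B'
    using that by (simp add: fps_mult_nth R_def)
  have one: "R 1 1" by (simp add: R_def)
  have pow: "R (A ^ l) (B ^ l)" if "R A B" for A B l
    by (induction l) (use that one in \<open>auto intro: mult\<close>)
  have "R (1 - fps_X ^ Suc n) (1 - fps_X ^ Suc n)" for n
    by (simp add: fps_X_power_nth R_def del: power_Suc)
  hence factor: "R ((1 - fps_X ^ Suc n) ^ 24) ((1 - fps_X ^ Suc n) ^ 24)" for n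
    by (rule pow)
  have "R (\<Prod>n<N. (1 - fps_X ^ Suc n) ^ 24) (\<Prod>n<N. (1 - fps_X ^ Suc n) ^ 24)"
  proof (induction N)
    case (Suc N)
    show ?case
      unfolding prod.lessThan_Suc by (intro mult Suc.IH factor)
  qed (simp add: one)
  thus ?thesis unfolding R_def euler_partial_def by blast
qed

text \<open>Convergence of formal power series follows from coefficients being eventually constant,
  so the infinite product is read off from its partial products. The factor \<open>fps_X\<close>
  shifts the index by one.\<close>

lemma ramanujan_tau_0: "ramanujan_tau 0 = 0"
  and ramanujan_tau_Suc: "ramanujan_tau (Suc m) = fps_nth (euler_partial m) m"
proof -
  define L :: "int fps" where "L = Abs_fps (\<lambda>m. fps_nth (euler_partial m) m)"
  have lim: "(euler_partial :: nat \<Rightarrow> int fps) \<longlonglongrightarrow> L"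
  proof (rule tendsto_fpsI)
    show "\<forall>\<^sub>F N in sequentially. fps_nth (euler_partial N) n = fps_nth L n" for n
      using eventually_ge_at_top[of n] by eventually_elim (simp add: L_def, erule euler_partial_stable)
  qed
  have "(\<lambda>n. (1 - fps_X ^ Suc n :: int fps) ^ 24) has_prod L"
    unfolding has_prod_def raw_has_prod_def
  proof (intro disjI1 conjI)
    have "(\<lambda>n. euler_partial (Suc n) :: int fps) \<longlonglongrightarrow> L"
      using lim by (rule LIMSEQ_Suc)
    thus "(\<lambda>n. \<Prod>i\<le>n. (1 - fps_X ^ Suc (i + 0)) ^ 24) \<longlonglongrightarrow> L"
      unfolding euler_partial_def lessThan_Suc_atMost add_0_right .
    \<comment> \<open>The chosen case of \<open>has_prod\<close> demands a nonzero limit, and the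
      constant coefficient provides it.\<close>
    have "fps_nth L 0 = 1"
      by (simp add: L_def euler_partial_def)
    thus "L \<noteq> 0" by (metis fps_zero_nth zero_neq_one)
  qed
  hence "(\<Prod>n. (1 - fps_X ^ Suc n :: int fps) ^ 24) = L"
    by (rule has_prod_unique[symmetric])
  hence *: "ramanujan_tau m = fps_nth (fps_X * L) m" for m
    unfolding ramanujan_tau_def by (simp only:)
  show "ramanujan_tau 0 = 0" "ramanujan_tau (Suc m) = fps_nth (euler_partial m) m"
    unfolding * by (simp_all add: fps_X_mult_nth L_def)
qed

text \<open>The partial products converge coefficientwise to the formal product and uniformly on a
  small disc to the analytic one, so the two have the same expansion at 0. Holomorphy on the unit
  disc then extends the expansion to all \<open>norm q < 1\<close>.\<close>

lemma euler_product_sums: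
  assumes q: "norm q < 1"
  shows "(\<lambda>m. of_int (ramanujan_tau (Suc m)) * q ^ m) sums (qpoch q q ^ 24)"
proof -
  define L :: "complex fps" where "L = Abs_fps (\<lambda>m. of_int (ramanujan_tau (Suc m)))"
  define f where "f = (\<lambda>q. qpoch q q ^ 24)"
  have holo: "f holomorphic_on ball 0 1"
    unfolding f_def by (intro holomorphic_intros) auto
  have lim: "(euler_partial :: nat \<Rightarrow> complex fps) \<longlonglongrightarrow> L"
  proof (rule tendsto_fpsI)
    show "\<forall>\<^sub>F N in sequentially. fps_nth (euler_partial N) n = fps_nth L n" for n
      using eventually_ge_at_top[of n]
      by eventually_elim (simp add: L_def euler_partial_of_int ramanujan_tau_Suc, erule euler_partial_stable)
  qed
  have exp: "f has_fps_expansion fps_expansion f 0"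
    using holo by (intro analytic_at_imp_has_fps_expansion_0 holomorphic_on_imp_analytic_at) auto
  have ul: "uniform_limit (cball 0 (1/2)) (\<lambda>N x. \<Prod>n<N. 1 - x * x ^ n) (\<lambda>x. qpoch x x) sequentially"
    by (rule uniform_limit_qpoch) (auto intro!: continuous_intros)
  \<comment> \<open>A product of uniformly convergent sequences converges uniformly when the limits
    are bounded; the bounds come from compactness of the closed disc.\<close>
  have ul: "uniform_limit (ball 0 (1/2)) (\<lambda>N x. (\<Prod>n<N. 1 - x * x ^ n) ^ l) (\<lambda>x. qpoch x x ^ l) sequentially" for l
  proof (induction l)
    case (Suc l)
    have bd: "bounded ((\<lambda>x. qpoch x x ^ l) ` ball 0 (1/2))" for l
    proof (rule bounded_subset)
      have "(\<lambda>x. qpoch x x ^ l) holomorphic_on ball 0 1"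
        by (intro holomorphic_intros) auto
      hence "continuous_on (cball 0 (1/2)) (\<lambda>x. qpoch x x ^ l)"
        by (rule holomorphic_on_imp_continuous_on[OF holomorphic_on_subset]) auto
      thus "bounded ((\<lambda>x. qpoch x x ^ l) ` cball 0 (1/2))"
        by (intro compact_imp_bounded compact_continuous_image) auto
    qed auto
    show ?case
      unfolding power_Suc using bd[of 1] bd[of l]
      by (intro uniform_lim_mult uniform_limit_on_subset[OF ul] Suc.IH) auto
  qed (auto intro: uniform_limit_const)
  have "fps_expansion f 0 = L"
  proof (rule uniform_limit_imp_fps_expansion_eq[OF lim _ _ exp, where A = "ball 0 (1/2)"])
    show "uniform_limit (ball 0 (1/2)) (\<lambda>N x. \<Prod>n<N. (1 - x ^ Suc n) ^ 24) f sequentially"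
      using ul[of 24] by (simp add: f_def prod_power_distrib)
    show "\<forall>\<^sub>F N in sequentially. (\<lambda>x. \<Prod>n<N. (1 - x ^ Suc n) ^ 24) has_fps_expansion euler_partial N"
      unfolding euler_partial_def
      by (intro always_eventually allI fps_expansion_intros)
    show "\<forall>\<^sub>F N in sequentially. (\<lambda>x. \<Prod>n<N. (1 - x ^ Suc n) ^ 24) holomorphic_on ball 0 (1/2)"
      by (intro always_eventually allI holomorphic_intros)
  qed auto
  moreover have "f holomorphic_on eball 0 (ereal 1)"
    using holo by simp
  ultimately have "(\<lambda>m. fps_nth L m * q ^ m) sums f q"
    using has_fps_expansion_imp_sums_complex[OF exp, of "ereal 1" q] q by simp
  thus ?thesis by (simp add: L_def f_def)
qed

lemma discr_sums:
  assumes "Im t > 0"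
  shows "(\<lambda>m. of_int (ramanujan_tau (Suc m)) * nome t ^ Suc m) sums discr t"
  using sums_mult[OF euler_product_sums[of "nome t"], of "nome t"] assms
  by (simp add: discr_def mult_ac)


section \<open>Mean squares and absolute convergence\<close>

lemma cnj_nome: "cnj (nome z) = nome (- cnj z)"
  by (simp add: nome_def exp_cnj)

lemma norm_nome_of_real [simp]: "norm (nome (of_real x)) = 1"
  by (simp add: norm_nome)

text \<open>Orthogonality of the characters of the cyclic group of order \<open>K\<close>. Distinct
  \<open>m, n < K\<close> are incongruent modulo \<open>K\<close>, so \<open>w\<close> is a
  nontrivial \<open>K\<close>-th root of unity and its geometric sum vanishes.\<close>

lemma sum_nome_orthogonal:
  fixes m n K :: nat
  assumes "m < K" "n < K"
  shows "(\<Sum>k<K. nome (of_nat n * (of_nat k / of_nat K)) * cnj (nome (of_nat m * (of_nat k / of_nat K))))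
           = (if m = n then of_nat K else 0)"
proof -
  define w where "w = nome ((of_nat n - of_nat m) / of_nat K)"
  have K: "K > 0" using assms by auto
  have "(\<Sum>k<K. nome (of_nat n * (of_nat k / of_nat K)) * cnj (nome (of_nat m * (of_nat k / of_nat K)))) = (\<Sum>k<K. w ^ k)"
  proof (rule sum.cong)
    fix k
    have "of_nat n * (of_nat k / of_nat K) + - cnj (of_nat m * (of_nat k / of_nat K))
        = of_nat k * ((of_nat n - of_nat m) / of_nat K :: complex)"
      by (simp add: algebra_simps diff_divide_distrib)
    thus "nome (of_nat n * (of_nat k / of_nat K)) * cnj (nome (of_nat m * (of_nat k / of_nat K))) = w ^ k"
      unfolding cnj_nome w_def nome_power nome_add[symmetric] by (simp only:)
  qed auto
  also have "\<dots> = (if m = n then of_nat K else 0)"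
  proof (cases "m = n")
    case False
    have "w \<noteq> 1"
    proof
      assume "w = 1"
      then obtain j where "(of_nat n - of_nat m) / of_nat K = (of_int j :: complex)"
        unfolding w_def nome_eq_1_iff by (elim Ints_cases)
      hence "of_int (int n - int m) = (of_int (j * int K) :: complex)"
        using K by (simp add: field_simps)
      hence j: "int n - int m = j * int K"
        by (simp only: of_int_eq_iff)
      hence "j \<noteq> 0" using False by auto
      hence "int K \<le> \<bar>j * int K\<bar>"
        using mult_right_mono[of 1 "\<bar>j\<bar>" "int K"] by (simp add: abs_mult)
      with j assms show False by linarith
    qed
    moreover have "w ^ K = nome (of_int (int n - int m))"
      unfolding w_def nome_power using K by simp
    hence "w ^ K = 1"
      by (simp add: nome_eq_1_iff del: of_int_diff)
    ultimately show ?thesis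
      using False by (simp add: sum_gp_strict)
  qed (simp add: w_def)
  finally show ?thesis .
qed

text \<open>Sampling at \<open>K\<close> equally spaced points gives Parseval's identity for
  \<open>K\<close> terms as a finite computation.\<close>

lemma discrete_parseval:
  fixes c :: "nat \<Rightarrow> complex"
  shows "(\<Sum>k<K. (norm (\<Sum>n<K. c n * nome (of_nat n * (of_nat k / of_nat K))))\<^sup>2) = real K * (\<Sum>n<K. (norm (c n))\<^sup>2)"
proof -
  let ?e = "\<lambda>n k. nome (of_nat n * (of_nat k / of_nat K))"
  have "of_real (\<Sum>k<K. (norm (\<Sum>n<K. c n * ?e n k))\<^sup>2)
      = (\<Sum>k<K. \<Sum>n<K. \<Sum>m<K. c n * cnj (c m) * (?e n k * cnj (?e m k)))"
    by (simp add: complex_norm_square sum_product mult_ac del: of_real_power)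
  also have "\<dots> = (\<Sum>n<K. \<Sum>k<K. \<Sum>m<K. c n * cnj (c m) * (?e n k * cnj (?e m k)))"
    by (rule sum.swap)
  also have "\<dots> = (\<Sum>n<K. \<Sum>m<K. \<Sum>k<K. c n * cnj (c m) * (?e n k * cnj (?e m k)))"
    by (intro sum.cong refl sum.swap)
  also have "\<dots> = (\<Sum>n<K. \<Sum>m<K. c n * cnj (c m) * (if m = n then of_nat K else 0))"
    unfolding sum_distrib_left[symmetric]
    by (intro sum.cong refl arg_cong2[of _ _ _ _ "(*)"] sum_nome_orthogonal) auto
  also have "\<dots> = (\<Sum>n<K. c n * cnj (c n) * of_nat K)"
    by (intro sum.cong refl) (simp add: if_distrib cong: if_cong)
  also have "\<dots> = of_real (real K * (\<Sum>n<K. (norm (c n))\<^sup>2))"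
    by (simp add: complex_norm_square sum_distrib_left mult_ac del: of_real_power)
  finally show ?thesis
    unfolding of_real_eq_iff .
qed

text \<open>Cutting the series after \<open>K\<close> terms costs at most the tail
  \<open>\<epsilon> K\<close> of the absolute series. The discrete identity therefore gives the
  bound \<open>(B + \<epsilon> K)\<^sup>2\<close>, and \<open>K\<close> tends to infinity.\<close>

lemma bessel_ineq_nome:
  fixes c :: "nat \<Rightarrow> complex"
  assumes sm: "summable (\<lambda>n. norm (c n))"
    and B: "\<And>x :: real. norm (\<Sum>n. c n * nome (of_nat n * of_real x)) \<le> B"
  shows "(\<Sum>n<N. (norm (c n))\<^sup>2) \<le> B\<^sup>2"
proof -
  define \<epsilon> where "\<epsilon> = (\<lambda>K. (\<Sum>n. norm (c n)) - (\<Sum>n<K. norm (c n)))"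
  have "(\<lambda>K. (B + \<epsilon> K)\<^sup>2) \<longlonglongrightarrow> (B + ((\<Sum>n. norm (c n)) - (\<Sum>n. norm (c n))))\<^sup>2"
    unfolding \<epsilon>_def by (intro tendsto_intros summable_LIMSEQ sm)
  hence lim: "(\<lambda>K. (B + \<epsilon> K)\<^sup>2) \<longlonglongrightarrow> B\<^sup>2" by simp
  have bound: "norm (\<Sum>n<K. c n * nome (of_nat n * of_real x)) \<le> B + \<epsilon> K" for K x
  proof -
    let ?f = "\<lambda>n. c n * nome (of_nat n * of_real x)"
    have nf: "norm (?f n) = norm (c n)" for n
      using norm_nome_of_real[of "real n * x"] by (simp add: norm_mult)
    have smf: "summable (\<lambda>n. norm (?f n))"
      unfolding nf by (rule sm)
    have "(\<Sum>n<K. ?f n) = (\<Sum>n. ?f n) - (\<Sum>n. ?f (n + K))"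
      using suminf_minus_initial_segment[OF summable_norm_cancel[OF smf], of K] by simp
    also have "norm \<dots> \<le> B + norm (\<Sum>n. ?f (n + K))"
      using norm_triangle_ineq4[of "\<Sum>n. ?f n" "\<Sum>n. ?f (n + K)"] B[of x] by linarith
    also have "norm (\<Sum>n. ?f (n + K)) \<le> (\<Sum>n. norm (?f (n + K)))"
      using smf by (intro summable_norm summable_ignore_initial_segment)
    also have "\<dots> = \<epsilon> K"
      unfolding \<epsilon>_def nf using suminf_minus_initial_segment[OF sm, of K] by simp
    finally show ?thesis by simp
  qed
  have "(\<Sum>n<N. (norm (c n))\<^sup>2) \<le> (B + \<epsilon> K)\<^sup>2" if K: "K \<ge> Suc N" for K
  proof -
    have "real K * (\<Sum>n<K. (norm (c n))\<^sup>2) = (\<Sum>k<K. (norm (\<Sum>n<K. c n * nome (of_nat n * of_real (real k / real K))))\<^sup>2)"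
      using discrete_parseval[of c K] by simp
    also have "\<dots> \<le> (\<Sum>k<K. (B + \<epsilon> K)\<^sup>2)"
      by (intro sum_mono power_mono bound norm_ge_zero)
    also have "\<dots> = real K * (B + \<epsilon> K)\<^sup>2" by simp
    finally have "(\<Sum>n<K. (norm (c n))\<^sup>2) \<le> (B + \<epsilon> K)\<^sup>2"
      using K by simp
    moreover have "(\<Sum>n<N. (norm (c n))\<^sup>2) \<le> (\<Sum>n<K. (norm (c n))\<^sup>2)"
      using K by (intro sum_mono2) auto
    ultimately show ?thesis by linarith
  qed
  thus ?thesis
    by (intro LIMSEQ_le_const[OF lim]) blast
qed

section \<open>Mean squares of the coefficients\<close>

lemma tau_abs_summable_exp:
  assumes "y > 0"
  shows "summable (\<lambda>n. \<bar>real_of_int (ramanujan_tau n)\<bar> * exp (- 2 * pi * y * n))"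
proof -
  \<comment> \<open>Convergence of the power series at the larger modulus
    \<open>exp (- pi * y)\<close> forces absolute convergence at
    \<open>exp (- 2 * pi * y)\<close>.\<close>
  have "summable (\<lambda>m. of_int (ramanujan_tau (Suc m)) * nome (\<i> * (y/2)) ^ m)"
    using euler_product_sums[of "nome (\<i> * (y/2))"] assms by (auto simp: sums_iff)
  moreover have "norm (nome (\<i> * y)) < norm (nome (\<i> * (y/2)))"
    using assms by (simp add: norm_nome)
  ultimately have "summable (\<lambda>m. norm (of_int (ramanujan_tau (Suc m)) * nome (\<i> * y) ^ m :: complex))"
    by (rule powser_insidea)
  hence "summable (\<lambda>m. exp (- 2 * pi * y) * norm (of_int (ramanujan_tau (Suc m)) * nome (\<i> * y) ^ m :: complex))"
    by (rule summable_mult)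
  also have "(\<lambda>m. exp (- 2 * pi * y) * norm (of_int (ramanujan_tau (Suc m)) * nome (\<i> * y) ^ m :: complex))
     = (\<lambda>m. \<bar>real_of_int (ramanujan_tau (Suc m))\<bar> * exp (- 2 * pi * y * Suc m))"
    by (simp add: fun_eq_iff norm_mult norm_power norm_nome exp_of_nat_mult[symmetric] ring_distribs exp_add[symmetric] exp_diff exp_minus field_simps)
  finally show ?thesis
    by (subst (asm) summable_Suc_iff)
qed

lemma discr_sums_tau:
  assumes "y > 0"
  shows "(\<lambda>n. of_int (ramanujan_tau n) * of_real (exp (- 2 * pi * y * n)) * nome (of_nat n * of_real x)) sums discr (Complex x y)"
proof -
  have e: "nome (Complex x y) ^ n = of_real (exp (- 2 * pi * y * n)) * nome (of_nat n * of_real x)" for n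
  proof -
    have *: "2 * of_real pi * \<i> * (of_nat n * Complex x y) = of_real (- 2 * pi * y * n) + 2 * of_real pi * \<i> * (of_nat n * of_real x)"
      by (simp add: complex_eq_iff)
    thus ?thesis
      by (simp only: nome_power) (simp only: nome_def * exp_add exp_of_real)
  qed
  have "(\<lambda>n. of_int (ramanujan_tau (Suc n)) * nome (Complex x y) ^ Suc n) sums discr (Complex x y)"
    using assms by (intro discr_sums) auto
  from sums_Suc[OF this] show ?thesis
    unfolding e by (simp add: ramanujan_tau_0 mult.assoc)
qed

text \<open>At height \<open>y\<close> the numbers \<open>\<tau>(n) exp (- 2 * pi * y * n)\<close>
  are the Fourier coefficients of \<Delta>, which is bounded there by \<open>C / y ^ 6\<close>;
  Bessel's inequality squares this.\<close>

lemma tau_square_bound: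
  obtains C where "C > 0"
    "\<And>y N. y > 0 \<Longrightarrow> (\<Sum>n<N. (real_of_int (ramanujan_tau n))\<^sup>2 * exp (- 4 * pi * y * n)) \<le> C / y ^ 12"
proof -
  obtain C where C: "C > 0" "\<And>t. Im t > 0 \<Longrightarrow> norm (discr t) * Im t ^ 6 \<le> C"
    by (rule discr_weight_bound) blast
  show thesis
  proof (rule that[of "C\<^sup>2"])
    fix y :: real and N assume y: "y > 0"
    let ?c = "\<lambda>n. of_int (ramanujan_tau n) * of_real (exp (- 2 * pi * y * n)) :: complex"
    have nc: "norm (?c n) = \<bar>real_of_int (ramanujan_tau n)\<bar> * exp (- 2 * pi * y * n)" for n
      by (simp add: norm_mult)
    have "(\<Sum>n<N. (norm (?c n))\<^sup>2) \<le> (C / y ^ 6)\<^sup>2"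
    proof (rule bessel_ineq_nome)
      show "summable (\<lambda>n. norm (?c n))"
        unfolding nc by (rule tau_abs_summable_exp[OF y])
      fix x :: real
      show "norm (\<Sum>n. ?c n * nome (of_nat n * of_real x)) \<le> C / y ^ 6"
        using sums_unique[OF discr_sums_tau[OF y, of x]] C(2)[of "Complex x y"] y
        by (simp add: field_simps)
    qed
    moreover have "(norm (?c n))\<^sup>2 = (real_of_int (ramanujan_tau n))\<^sup>2 * exp (- 4 * pi * y * n)" for n
      unfolding nc by (simp add: power_mult_distrib exp_of_nat_mult[symmetric] mult_ac)
    ultimately show "(\<Sum>n<N. (real_of_int (ramanujan_tau n))\<^sup>2 * exp (- 4 * pi * y * n)) \<le> C\<^sup>2 / y ^ 12"
      by (simp add: power_divide power_mult[symmetric])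
  qed (use C in auto)
qed

lemma dyadic_bracket:
  fixes n :: nat
  assumes "n > 0"
  obtains k where "n \<le> 2 ^ k" "2 ^ k \<le> 2 * n"
proof -
  define k where "k = (LEAST k. n \<le> 2 ^ k)"
  have k: "n \<le> 2 ^ k"
    unfolding k_def by (rule LeastI[of _ n]) (simp add: less_imp_le)
  have "2 ^ k \<le> 2 * n"
  proof (cases k)
    case (Suc j)
    hence "\<not> n \<le> 2 ^ j"
      using not_less_Least[of j "\<lambda>k. n \<le> 2 ^ k"] by (simp add: k_def)
    thus ?thesis using Suc by simp
  qed (use assms in auto)
  with k show thesis by (rule that)
qed

text \<open>
  Weighting the mean-square bound at the heights \<open>2\<^sup>-\<^sup>k\<close> with \<open>2\<^sup>-\<^sup>k\<^sup>s\<close> replaces a partial summation.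
\<close>

lemma tau_square_summable:
  assumes s: "s > 12"
  shows "summable (\<lambda>n. (real_of_int (ramanujan_tau (Suc n)))\<^sup>2 * real (Suc n) powr (- s))"
proof -
  obtain C where C: "C > 0"
    "\<And>y N. y > 0 \<Longrightarrow> (\<Sum>n<N. (real_of_int (ramanujan_tau n))\<^sup>2 * exp (- 4 * pi * y * n)) \<le> C / y ^ 12"
    by (rule tau_square_bound) blast
  \<comment> \<open>\<open>D\<close> pays for the dyadic rounding: \<open>2 ^ k \<le> 2 * n\<close>
    costs \<open>2 powr s\<close>, and \<open>n \<le> 2 ^ k\<close> keeps the exponential weight
    above \<open>exp (- 4 * pi)\<close>.\<close>
  define D where "D = 2 powr s * exp (4 * pi)"
  define b where "b = (\<lambda>n. (real_of_int (ramanujan_tau n))\<^sup>2)"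
  define G where "G = (\<lambda>k n. (2 powr (-s)) ^ k * (b n * exp (- 4 * pi * (1 / 2 ^ k) * real n)))"
  \<comment> \<open>At height \<open>1 / 2 ^ k\<close> the mean square is at most
    \<open>C * (2 ^ 12) ^ k\<close>, so the weights leave a geometric series of ratio
    \<open>r\<close>, and \<open>r < 1\<close> is exactly the condition
    \<open>s > 12\<close>.\<close>
  define r where "r = 2 powr (12 - s)"
  have r: "0 < r" "r < 1"
    using s by (auto simp: r_def intro!: powr_less_one)
  have "\<exists>k :: nat \<Rightarrow> nat. \<forall>n::nat. n > 0 \<longrightarrow> n \<le> 2 ^ k n \<and> 2 ^ k n \<le> 2 * n"
    by (intro choice allI) (meson dyadic_bracket)
  then obtain k :: "nat \<Rightarrow> nat" where k: "\<And>n. n > 0 \<Longrightarrow> n \<le> 2 ^ k n" "\<And>n. n > 0 \<Longrightarrow> 2 ^ k n \<le> 2 * n"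
    by blast
  have term_le: "b n * real n powr (- s) \<le> D * G (k n) n" if n: "n > 0" for n
  proof -
    have "real (2 ^ k n) \<le> real (2 * n)"
      using k(2)[OF n] by (simp only: of_nat_le_iff)
    hence "real (2 * n) powr (- s) \<le> real (2 ^ k n) powr (- s)"
      using s by (intro powr_mono2') auto
    also have "\<dots> = (2 powr (-s)) ^ k n"
      by (simp add: powr_power powr_realpow[symmetric] powr_powr mult_ac)
    finally have "2 powr s * real (2 * n) powr (- s) \<le> 2 powr s * (2 powr (-s)) ^ k n"
      by (intro mult_left_mono) auto
    moreover have "2 powr s * real (2 * n) powr (- s) = real n powr (- s)"
      by (simp add: powr_mult powr_minus)
    ultimately have 1: "real n powr (- s) \<le> 2 powr s * (2 powr (-s)) ^ k n"
      by (simp only:)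
    have "real n \<le> real (2 ^ k n)"
      using k(1)[OF n] by (simp only: of_nat_le_iff)
    hence "4 * pi * (1 / 2 ^ k n) * real n \<le> 4 * pi"
      by (simp add: field_simps)
    hence 2: "1 \<le> exp (4 * pi) * exp (- 4 * pi * (1 / 2 ^ k n) * real n)"
      by (simp add: exp_add[symmetric])
    have "b n * real n powr (- s) \<le> b n * (2 powr s * (2 powr (-s)) ^ k n)"
      by (intro mult_left_mono 1) (auto simp: b_def)
    also have "\<dots> \<le> b n * (2 powr s * (2 powr (-s)) ^ k n) * (exp (4 * pi) * exp (- 4 * pi * (1 / 2 ^ k n) * real n))"
      using mult_left_mono[OF 2, of "b n * (2 powr s * (2 powr (-s)) ^ k n)"] by (simp add: b_def)
    also have "\<dots> = D * G (k n) n"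
      by (simp add: D_def G_def mult_ac)
    finally show ?thesis .
  qed
  have G_nonneg: "G k n \<ge> 0" for k n
    by (simp add: G_def b_def)
  have G_sum: "(\<Sum>n<N. G k n) \<le> C * r ^ k" for k N
  proof -
    have "(\<Sum>n<N. G k n) = (2 powr (-s)) ^ k * (\<Sum>n<N. b n * exp (- 4 * pi * (1 / 2 ^ k) * real n))"
      by (simp add: G_def sum_distrib_left)
    also have "\<dots> \<le> (2 powr (-s)) ^ k * (C / (1 / 2 ^ k) ^ 12)"
      unfolding b_def by (intro mult_left_mono C(2)) auto
    also have "(1 / 2 ^ k) ^ 12 = 1 / (2 ^ 12 :: real) ^ k"
      by (simp only: power_divide power_one power_mult[symmetric] mult.commute)
    also have "(2 powr (-s)) ^ k * (C / (1 / (2 ^ 12) ^ k)) = C * (2 powr (-s) * 2 ^ 12) ^ k"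
      by (simp add: power_mult_distrib)
    also have "2 powr (-s) * 2 ^ 12 = r"
      by (simp add: r_def powr_diff powr_minus field_simps)
    finally show ?thesis .
  qed
  have "(\<Sum>n<N. b (Suc n) * real (Suc n) powr (- s)) \<le> D * (C * (1 / (1 - r)))" for N
  proof -
    \<comment> \<open>\<open>K\<close> exceeds every dyadic exponent that occurs up to
      \<open>N\<close>, so each term is one summand of a finite double sum whose order can be
      exchanged.\<close>
    define K where "K = Suc (Max (k ` {..N}))"
    have kK: "k n < K" if "n \<le> N" for n
      using that by (auto simp: K_def less_Suc_eq_le intro!: Max_ge)
    have "(\<Sum>n<N. b (Suc n) * real (Suc n) powr (- s)) \<le> (\<Sum>n<N. D * (\<Sum>j<K. G j (Suc n)))"
    proof (rule sum_mono)
      fix n assume n: "n \<in> {..<N}"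
      have "G (k (Suc n)) (Suc n) \<le> (\<Sum>j<K. G j (Suc n))"
        using n by (intro member_le_sum kK) (auto simp: G_nonneg intro!: kK)
      thus "b (Suc n) * real (Suc n) powr (- s) \<le> D * (\<Sum>j<K. G j (Suc n))"
        using term_le[of "Suc n"] mult_left_mono[of _ _ D] by (smt (verit) D_def exp_gt_zero mult_nonneg_nonneg powr_ge_zero zero_less_Suc)
    qed
    also have "\<dots> = D * (\<Sum>j<K. \<Sum>n<N. G j (Suc n))"
      unfolding sum_distrib_left[symmetric] by (subst sum.swap) simp
    also have "\<dots> \<le> D * (\<Sum>j<K. C * r ^ j)"
    proof (intro mult_left_mono sum_mono)
      fix j
      have "(\<Sum>n<N. G j (Suc n)) \<le> (\<Sum>n<Suc N. G j n)"
        using G_nonneg[of j 0] unfolding sum.lessThan_Suc_shift by simp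
      thus "(\<Sum>n<N. G j (Suc n)) \<le> C * r ^ j"
        using G_sum[of j "Suc N"] by linarith
    qed (auto simp: D_def)
    also have "\<dots> \<le> D * (C * (1 / (1 - r)))"
      unfolding sum_distrib_left[symmetric] using r C(1)
      by (intro mult_left_mono) (auto simp: D_def sum_gp_strict divide_right_mono)
    finally show ?thesis .
  qed
  hence "summable (\<lambda>n. b (Suc n) * real (Suc n) powr (- s))"
    by (intro bounded_imp_summable[where B = "D * (C * (1 / (1 - r)))"])
       (auto simp: b_def lessThan_Suc_atMost[symmetric] simp del: sum.lessThan_Suc)
  thus ?thesis by (simp add: b_def)
qed

text \<open>Cauchy-Schwarz in the form \<open>a * b \<le> a\<^sup>2 + b\<^sup>2\<close>. With
  \<open>s = 13/2 + e\<close> the power splits so that \<open>a\<^sup>2\<close> is the mean-square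
  term with exponent \<open>12 + e > 12\<close> and \<open>b\<^sup>2\<close> is a zeta term with
  exponent \<open>1 + e > 1\<close>.\<close>

lemma tau_abs_summable:
  assumes s: "s > 13 / 2"
  shows "summable (\<lambda>n. \<bar>real_of_int (ramanujan_tau (Suc n))\<bar> * real (Suc n) powr (- s))"
proof -
  define e where "e = s - 13 / 2"
  have e: "e > 0" using s by (simp add: e_def)
  have "summable (\<lambda>n. real (Suc n) powr (- (1 + e)))"
    using e by (subst summable_Suc_iff[of "\<lambda>n. real n powr (- (1 + e))"]) (simp add: summable_real_powr_iff)
  hence "summable (\<lambda>n. (real_of_int (ramanujan_tau (Suc n)))\<^sup>2 * real (Suc n) powr (- (12 + e)) + real (Suc n) powr (- (1 + e)))"
    using e by (intro summable_add tau_square_summable) auto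
  thus ?thesis
  proof (rule summable_comparison_test_ev[rotated], intro always_eventually allI)
    fix n :: nat
    define x where "x = real (Suc n)"
    define a where "a = \<bar>real_of_int (ramanujan_tau (Suc n))\<bar> * x powr (- (6 + e/2))"
    define b where "b = x powr (- (1/2 + e/2))"
    have x: "x > 0" by (simp add: x_def)
    have "a\<^sup>2 = (real_of_int (ramanujan_tau (Suc n)))\<^sup>2 * x powr (- (12 + e))"
      using x by (simp add: a_def power_mult_distrib powr_power)
    moreover have "b\<^sup>2 = x powr (- (1 + e))"
      using x by (simp add: b_def powr_power algebra_simps)
    moreover have "a * b = \<bar>real_of_int (ramanujan_tau (Suc n))\<bar> * x powr (- s)"
    proof -
      have "x powr (- (6 + e/2)) * x powr (- (1/2 + e/2)) = x powr (- s)"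
        by (simp add: powr_add[symmetric] e_def field_simps)
      thus ?thesis by (simp add: a_def b_def)
    qed
    moreover have "a * b \<le> a\<^sup>2 + b\<^sup>2"
    proof -
      have "a * b \<ge> 0" by (simp add: a_def b_def)
      thus ?thesis using sum_squares_bound[of a b] by simp
    qed
    ultimately show "norm (\<bar>real_of_int (ramanujan_tau (Suc n))\<bar> * real (Suc n) powr (- s))
        \<le> (real_of_int (ramanujan_tau (Suc n)))\<^sup>2 * real (Suc n) powr (- (12 + e)) + real (Suc n) powr (- (1 + e))"
      unfolding x_def[symmetric] by simp
  qed
qed


section \<open>The Fourier transform of the discriminant on the imaginary axis\<close>

text \<open>Euler's integral in the logarithmic variable: the substitution \<open>t = exp u\<close>
  settles \<open>a = 1\<close>, and the translation of \<open>u\<close> by \<open>ln a\<close> gives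
  the general case.\<close>

lemma log_Gamma_integral:
  fixes s :: complex
  assumes s: "Re s > 0" and a: "a > 0"
  defines "f \<equiv> \<lambda>u :: real. exp (s * of_real u - of_real (a * exp u))"
  shows "integrable lborel f" "integral\<^sup>L lborel f = of_real a powr (- s) * Gamma s"
proof -
  define g where "g = (\<lambda>u :: real. exp (s * of_real u - of_real (exp u)))"
  have "(\<lambda>x. \<bar>exp x\<bar> *\<^sub>R (of_real (exp x) powr (s - 1) / of_real (exp (exp x)))) absolutely_integrable_on UNIV \<and>
      integral UNIV (\<lambda>x. \<bar>exp x\<bar> *\<^sub>R (of_real (exp x) powr (s - 1) / of_real (exp (exp x)))) = Gamma s
    \<longleftrightarrow> (\<lambda>t. of_real t powr (s - 1) / of_real (exp t)) absolutely_integrable_on range (exp :: real \<Rightarrow> real) \<and>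
      integral (range exp) (\<lambda>t :: real. of_real t powr (s - 1) / of_real (exp t)) = Gamma s"
    by (rule has_absolute_integral_change_of_variables_real)
       (auto intro!: derivative_eq_intros inj_onI)
  moreover have "range (exp :: real \<Rightarrow> real) = {0<..}"
    by (auto simp: image_iff) (metis exp_ln)
  moreover have "\<bar>exp x\<bar> *\<^sub>R (of_real (exp x) powr (s - 1) / of_real (exp (exp x))) = g x" for x :: real
  proof -
    have "of_real (exp x) powr (s - 1) = exp ((s - 1) * of_real x)"
      by (simp add: powr_def Ln_of_real)
    thus ?thesis
      by (simp add: g_def scaleR_conv_of_real exp_of_real[symmetric] exp_add[symmetric] exp_diff[symmetric] algebra_simps)
  qed
  ultimately have g: "g absolutely_integrable_on UNIV" "integral UNIV g = Gamma s"
    using absolutely_integrable_Gamma_integral'[OF s] Gamma_integral_complex'[OF s] by (simp_all add: integral_unique)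
  have gm: "g \<in> borel_measurable borel"
    unfolding g_def by (intro borel_measurable_continuous_onI continuous_intros)
  have gi: "integrable lborel g"
    using g(1) gm by (simp add: set_integrable_def integrable_completion)
  hence gv: "integral\<^sup>L lborel g = Gamma s"
    using integral_lborel g(2) by metis
  have "f u = of_real a powr (- s) * g (ln a + 1 * u)" for u
  proof -
    have "s * of_real u = - s * of_real (ln a) + s * of_real (ln a + u)"
      by (simp add: algebra_simps)
    moreover have "exp (ln a + u) = a * exp u"
      using a by (simp add: exp_add)
    moreover have "of_real a powr (- s) = exp (- s * of_real (ln a))"
      using a by (simp add: powr_def flip: Ln_of_real)
    ultimately show ?thesis
      unfolding f_def g_def by (simp add: exp_add[symmetric] algebra_simps)
  qed
  hence f: "f = (\<lambda>u. of_real a powr (- s) * g (ln a + 1 * u))"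
    by blast
  show "integrable lborel f"
    unfolding f by (intro integrable_mult_right lborel_integrable_real_affine gi) auto
  have "integral\<^sup>L lborel g = integral\<^sup>L lborel (\<lambda>u. g (ln a + 1 * u))"
    using lborel_integral_real_affine[of 1 g "ln a"] by simp
  thus "integral\<^sup>L lborel f = of_real a powr (- s) * Gamma s"
    unfolding f using gv by simp
qed

lemma log_Gamma_integral_real:
  fixes s :: real
  assumes s: "s > 0" and a: "a > 0"
  shows "integrable lborel (\<lambda>u. exp (s * u - a * exp u))"
    "integral\<^sup>L lborel (\<lambda>u. exp (s * u - a * exp u)) = a powr (- s) * Gamma s"
proof -
  have eq: "exp (of_real s * of_real u - of_real (a * exp u)) = (of_real (exp (s * u - a * exp u)) :: complex)" for u
    by (simp add: exp_of_real[symmetric])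
  have I: "integrable lborel (\<lambda>u. of_real (exp (s * u - a * exp u)) :: complex)"
    "integral\<^sup>L lborel (\<lambda>u. of_real (exp (s * u - a * exp u)) :: complex) = of_real a powr (- of_real s) * Gamma (of_real s)"
    using log_Gamma_integral[of "of_real s" a] assms unfolding eq by simp_all
  from I(1) show "integrable lborel (\<lambda>u. exp (s * u - a * exp u))"
    unfolding complex_of_real_integrable_eq .
  from I(2) have "of_real (integral\<^sup>L lborel (\<lambda>u. exp (s * u - a * exp u))) = (of_real (a powr (- s) * Gamma s) :: complex)"
    using a by (simp add: integral_complex_of_real powr_of_real[symmetric] Gamma_complex_of_real)
  thus "integral\<^sup>L lborel (\<lambda>u. exp (s * u - a * exp u)) = a powr (- s) * Gamma s"
    by (simp only: of_real_eq_iff)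
qed

section \<open>The positive even kernel\<close>

lemma euler_phi_pos:
  fixes q :: real
  assumes q: "0 < q" "q < 1"
  obtains p where "p > 0" "qpoch (of_real q) (of_real q) = of_real p"
proof -
  define P where "P = (\<lambda>N. \<Prod>n<N. 1 - q * q ^ n)"
  have lim: "(\<lambda>N. of_real (P N)) \<longlonglongrightarrow> qpoch (of_real q) (of_real q)"
    using qpoch_tendsto[of "of_real q" "of_real q"] q by (simp add: P_def)
  have P: "P N > 0" for N
    unfolding P_def using q power_Suc_less_one[of q] by (intro prod_pos) auto
  obtain p where p: "qpoch (of_real q) (of_real q) = of_real p"
    using Lim_in_closed_set[OF closed_complex_Reals _ _ lim] by (auto elim!: Reals_cases)
  have "P \<longlonglongrightarrow> p"
    using lim unfolding p by (simp add: tendsto_of_real_iff)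
  hence "p \<ge> 0"
    using P by (intro LIMSEQ_le_const) (auto intro: less_imp_le)
  moreover have "p \<noteq> 0"
    using euler_phi_nonzero[of "of_real q"] q p by auto
  ultimately show thesis
    using that[of p] p by simp
qed

text \<open>The kernel \<open>K\<close> of the opening comment. \<Delta> is real on the imaginary
  axis, so \<open>Re\<close> changes only the type. The exponent 6 is half the weight 12.\<close>

definition disc_kernel :: "real \<Rightarrow> real" where
  "disc_kernel u = Re (discr (\<i> * of_real (exp u))) * exp (6 * u)"

lemma disc_kernel_pos_eq:
  "disc_kernel u > 0" "discr (\<i> * of_real (exp u)) * of_real (exp (6 * u)) = of_real (disc_kernel u)"
proof -
  define q where "q = exp (- 2 * pi * exp u)"
  have "nome (\<i> * of_real (exp u)) = of_real q"
  proof -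
    have "2 * of_real pi * \<i> * (\<i> * of_real (exp u)) = complex_of_real (- 2 * pi * exp u)"
      by (simp add: complex_eq_iff)
    thus ?thesis unfolding nome_def q_def by (simp only: exp_of_real)
  qed
  moreover obtain p where p: "p > 0" "qpoch (of_real q) (of_real q) = of_real p"
    using euler_phi_pos[of q] by (auto simp: q_def)
  ultimately have "discr (\<i> * of_real (exp u)) = of_real (q * p ^ 24)"
    by (simp add: discr_def)
  thus "disc_kernel u > 0" "discr (\<i> * of_real (exp u)) * of_real (exp (6 * u)) = of_real (disc_kernel u)"
    using p by (simp_all add: disc_kernel_def q_def)
qed

text \<open>Inversion exchanges \<open>\<i> * exp u\<close> and \<open>\<i> * exp (- u)\<close> at
  the cost of \<open>t ^ 12 = exp (12 * u)\<close>, which the factors \<open>exp (6 * u)\<close> and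
  \<open>exp (- 6 * u)\<close> balance.\<close>

lemma disc_kernel_even: "disc_kernel (- u) = disc_kernel u"
proof -
  define t where "t = \<i> * complex_of_real (exp u)"
  have "- 1 / t = \<i> * of_real (exp (- u))"
    by (simp add: t_def exp_minus field_simps)
  moreover have "discr (- 1 / t) = t ^ 12 * discr t"
    by (rule discr_inversion) (simp add: t_def)
  moreover have "t ^ 12 = of_real (exp (12 * u))"
    by (simp add: t_def power_mult_distrib exp_of_nat_mult[symmetric] flip: of_real_power)
  ultimately have "discr (\<i> * of_real (exp (- u))) = of_real (exp (12 * u)) * discr t"
    by simp
  hence "disc_kernel (- u) = exp (12 * u) * Re (discr t) * exp (- 6 * u)"
    by (simp add: disc_kernel_def)
  also have "\<dots> = (exp (12 * u) * exp (- 6 * u)) * Re (discr t)"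
    by simp
  also have "exp (12 * u) * exp (- 6 * u) = exp (6 * u)"
    by (simp add: exp_add[symmetric])
  finally show ?thesis
    by (simp add: disc_kernel_def t_def mult_ac)
qed

lemma continuous_disc_kernel: "continuous_on UNIV disc_kernel"
proof -
  have "discr holomorphic_on {t. Im t > 0}"
    unfolding discr_def by (intro holomorphic_intros open_halfspace_Im_gt) auto
  hence "continuous_on {t. Im t > 0} discr"
    by (rule holomorphic_on_imp_continuous_on)
  hence "continuous_on UNIV (\<lambda>u. discr (\<i> * of_real (exp u)))"
    by (rule continuous_on_compose2) (auto intro!: continuous_intros)
  thus ?thesis
    unfolding disc_kernel_def by (intro continuous_intros)
qed

text \<open>By evenness only \<open>v = \<bar>u\<bar>\<close> matters. The growth
  \<open>exp ((6 + r) * v)\<close> is split into \<open>exp v\<close>, kept with one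
  \<open>exp (- exp v)\<close> as a majorant independent of \<open>r\<close>, and
  \<open>exp ((5 + r) * v)\<close>, which the remaining decay caps. This is where
  \<open>5 + r\<close> comes from.\<close>

lemma disc_kernel_bound:
  obtains M where "M > 0"
    "\<And>u r. r \<ge> 0 \<Longrightarrow> disc_kernel u * exp (r * \<bar>u\<bar>)
       \<le> M * exp ((5 + r) * ln (5 + r)) * (exp (u - exp u) + exp (- u - exp (- u)))"
proof -
  obtain M where M: "M > 0" "\<And>t. Im t \<ge> 1/2 \<Longrightarrow> norm (discr t) \<le> M * exp (- 2 * pi * Im t)"
    by (rule discr_decay) blast
  show thesis
  proof (rule that[OF M(1)])
    fix u r :: real assume r: "r \<ge> 0"
    define v where "v = \<bar>u\<bar>"
    define A where "A = 5 + r"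
    have A: "A > 0" using r by (simp add: A_def)
    have v: "exp v \<ge> 1" by (simp add: v_def)
    have "disc_kernel u = disc_kernel v"
      by (cases "u \<ge> 0") (simp_all add: v_def disc_kernel_even)
    also have "\<dots> \<le> norm (discr (\<i> * of_real (exp v))) * exp (6 * v)"
      unfolding disc_kernel_def by (intro mult_right_mono complex_Re_le_cmod) auto
    also have "\<dots> \<le> M * exp (- 2 * pi * exp v) * exp (6 * v)"
      using M(2)[of "\<i> * of_real (exp v)"] v by (intro mult_right_mono) auto
    finally have "disc_kernel u * exp (r * v) \<le> M * exp (- 2 * pi * exp v) * exp (6 * v) * exp (r * v)"
      by (intro mult_right_mono) auto
    also have "\<dots> = M * exp (A * v - (2 * pi - 1) * exp v + (v - exp v))"
      by (simp add: exp_add[symmetric] A_def algebra_simps)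
    also have "\<dots> \<le> M * exp (A * ln A + (v - exp v))"
    proof -
      \<comment> \<open>The function \<open>A * v - exp v\<close> is largest at
        \<open>v = ln A\<close>; the tangent inequality for \<open>exp\<close> at that point yields
        the bound.\<close>
      have "v - ln A \<le> exp (v - ln A) - 1"
        using exp_ge_add_one_self[of "v - ln A"] by linarith
      hence "A * (v - ln A) \<le> A * (exp v / A - 1)"
        using A by (intro mult_left_mono) (auto simp: exp_diff)
      also have "\<dots> = exp v - A"
        using A by (simp add: field_simps)
      finally have "A * v \<le> A * ln A + exp v"
        using A by (simp add: algebra_simps)
      moreover have "1 * exp v \<le> (2 * pi - 1) * exp v"
        using pi_ge_two by (intro mult_right_mono) auto
      ultimately have "A * v - (2 * pi - 1) * exp v \<le> A * ln A"
        by linarith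
      thus ?thesis
        using M(1) by simp
    qed
    also have "\<dots> = M * exp (A * ln A) * exp (v - exp v)"
      by (simp add: exp_add)
    also have "exp (v - exp v) \<le> exp (u - exp u) + exp (- u - exp (- u))"
      by (cases "u \<ge> 0") (simp_all add: v_def)
    finally show "disc_kernel u * exp (r * \<bar>u\<bar>)
       \<le> M * exp ((5 + r) * ln (5 + r)) * (exp (u - exp u) + exp (- u - exp (- u)))"
      using M(1) by (simp add: v_def A_def)
  qed
qed

lemma integrable_disc_majorant:
  "integrable lborel (\<lambda>u :: real. exp (u - exp u) + exp (- u - exp (- u)))"
proof -
  have "integrable lborel (\<lambda>u :: real. exp (u - exp u))"
    using log_Gamma_integral_real(1)[of 1 1] by simp
  moreover from lborel_integrable_real_affine[OF this, of "-1" 0]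
  have "integrable lborel (\<lambda>u :: real. exp (- u - exp (- u)))" by simp
  ultimately show ?thesis by (rule Bochner_Integration.integrable_add)
qed

section \<open>The Fourier transform as an entire function\<close>

definition disc_fourier :: "complex \<Rightarrow> complex" where
  "disc_fourier \<phi> = integral\<^sup>L lborel (\<lambda>u. of_real (disc_kernel u) * exp (\<i> * \<phi> * of_real u))"

lemma norm_disc_integrand:
  "norm (of_real (disc_kernel u) * exp (\<i> * \<phi> * of_real u)) = disc_kernel u * exp (- Im \<phi> * u)"
  using disc_kernel_pos_eq(1)[of u] by (simp add: norm_mult)

lemma disc_integrand_measurable:
  "(\<lambda>u. of_real (disc_kernel u) * exp (\<i> * \<phi> * of_real u)) \<in> borel_measurable borel"
  by (intro borel_measurable_continuous_onI continuous_intros continuous_disc_kernel)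

text \<open>Only \<open>Im \<phi>\<close> enters the modulus of the integrand, so the kernel bound
  is uniform on a strip. The same majorant serves integrability, growth and locally uniform
  convergence.\<close>

lemma disc_fourier_integrable:
  "integrable lborel (\<lambda>u. of_real (disc_kernel u) * exp (\<i> * \<phi> * of_real u))"
  and disc_integrand_bound: "\<exists>M>0. \<forall>r\<ge>0. \<forall>\<phi>. \<bar>Im \<phi>\<bar> \<le> r \<longrightarrow> (\<forall>u. norm (of_real (disc_kernel u) * exp (\<i> * \<phi> * of_real u))
        \<le> M * exp ((5 + r) * ln (5 + r)) * (exp (u - exp u) + exp (- u - exp (- u))))"
proof -
  obtain M where M: "M > 0" "\<And>u r. r \<ge> 0 \<Longrightarrow> disc_kernel u * exp (r * \<bar>u\<bar>)
       \<le> M * exp ((5 + r) * ln (5 + r)) * (exp (u - exp u) + exp (- u - exp (- u)))"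
    by (rule disc_kernel_bound) blast
  have *: "norm (of_real (disc_kernel u) * exp (\<i> * \<phi> * of_real u))
        \<le> M * exp ((5 + r) * ln (5 + r)) * (exp (u - exp u) + exp (- u - exp (- u)))"
    if "\<bar>Im \<phi>\<bar> \<le> r" "r \<ge> 0" for r u \<phi>
  proof -
    have "- Im \<phi> * u \<le> \<bar>Im \<phi>\<bar> * \<bar>u\<bar>"
      by (metis abs_ge_self abs_minus_cancel abs_mult)
    also have "\<dots> \<le> r * \<bar>u\<bar>"
      using that by (intro mult_right_mono) auto
    finally have "disc_kernel u * exp (- Im \<phi> * u) \<le> disc_kernel u * exp (r * \<bar>u\<bar>)"
      using disc_kernel_pos_eq(1)[of u] by (intro mult_left_mono) auto
    also note M(2)[OF that(2), of u]
    finally show ?thesis unfolding norm_disc_integrand .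
  qed
  thus "\<exists>M>0. \<forall>r\<ge>0. \<forall>\<phi>. \<bar>Im \<phi>\<bar> \<le> r \<longrightarrow> (\<forall>u. norm (of_real (disc_kernel u) * exp (\<i> * \<phi> * of_real u))
        \<le> M * exp ((5 + r) * ln (5 + r)) * (exp (u - exp u) + exp (- u - exp (- u))))"
    using M(1) by blast
  let ?c = "M * exp ((5 + \<bar>Im \<phi>\<bar>) * ln (5 + \<bar>Im \<phi>\<bar>))"
  have "integrable lborel (\<lambda>u. ?c * (exp (u - exp u) + exp (- u - exp (- u))))"
    by (intro integrable_mult_right integrable_disc_majorant)
  thus "integrable lborel (\<lambda>u. of_real (disc_kernel u) * exp (\<i> * \<phi> * of_real u))"
  proof (rule Bochner_Integration.integrable_bound)
    show "AE u in lborel. norm (of_real (disc_kernel u) * exp (\<i> * \<phi> * of_real u))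
        \<le> norm (?c * (exp (u - exp u) + exp (- u - exp (- u))))"
      by (intro AE_I2 order_trans[OF *[OF order_refl]]) auto
  qed (simp add: disc_integrand_measurable)
qed

text \<open>The majorant is integrated with \<open>r = norm \<phi>\<close>; \<open>I + 1\<close> in
  place of \<open>I\<close> makes the constant visibly positive.\<close>

lemma disc_fourier_growth:
  obtains M where "M > 0" "\<And>\<phi>. norm (disc_fourier \<phi>) \<le> M * exp ((5 + norm \<phi>) * ln (5 + norm \<phi>))"
proof -
  obtain M where M: "M > 0" "\<And>r \<phi> u. r \<ge> 0 \<Longrightarrow> \<bar>Im \<phi>\<bar> \<le> r \<Longrightarrow> norm (of_real (disc_kernel u) * exp (\<i> * \<phi> * of_real u))
        \<le> M * exp ((5 + r) * ln (5 + r)) * (exp (u - exp u) + exp (- u - exp (- u)))"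
    using disc_integrand_bound by blast
  define I where "I = integral\<^sup>L lborel (\<lambda>u :: real. exp (u - exp u) + exp (- u - exp (- u)))"
  have I: "I \<ge> 0"
    unfolding I_def by (intro integral_nonneg_AE) auto
  have "norm (disc_fourier \<phi>) \<le> (M * (I + 1)) * exp ((5 + norm \<phi>) * ln (5 + norm \<phi>))" for \<phi>
  proof -
    let ?c = "M * exp ((5 + norm \<phi>) * ln (5 + norm \<phi>))"
    have "norm (disc_fourier \<phi>) \<le> integral\<^sup>L lborel (\<lambda>u :: real. ?c * (exp (u - exp u) + exp (- u - exp (- u))))"
      unfolding disc_fourier_def
      by (rule order_trans[OF integral_norm_bound integral_mono])
         (use integrable_disc_majorant disc_fourier_integrable M(2)[of "norm \<phi>" \<phi>] abs_Im_le_cmod in \<open>auto intro!: integrable_norm\<close>)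
    also have "\<dots> = ?c * I"
      by (simp add: I_def)
    also have "\<dots> \<le> ?c * (I + 1)"
      using M(1) by (intro mult_left_mono) auto
    finally show ?thesis by (simp add: mult_ac)
  qed
  thus thesis using that[of "M * (I + 1)"] M(1) I by auto
qed

lemma disc_fourier_even: "disc_fourier (- \<phi>) = disc_fourier \<phi>"
  unfolding disc_fourier_def
  using lborel_integral_real_affine[of "-1" "\<lambda>u. of_real (disc_kernel u) * exp (\<i> * \<phi> * of_real u)" 0]
  by (simp add: disc_kernel_even)


text \<open>Integrals over compact intervals are holomorphic by differentiation under the integral.
  They converge uniformly on discs, since the error is a constant times the tail \<open>T n\<close>
  of the fixed majorant.\<close>

lemma disc_fourier_holomorphic: "disc_fourier holomorphic_on UNIV"
proof -
  define F where "F = (\<lambda>\<phi> u. of_real (disc_kernel u) * exp (\<i> * \<phi> * of_real u))"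
  define G where "G = (\<lambda>u :: real. exp (u - exp u) + exp (- u - exp (- u)))"
  define f where "f = (\<lambda>n \<phi>. integral (cbox (- real n) (real n)) (F \<phi>))"
  define T where "T = (\<lambda>n :: nat. integral\<^sup>L lborel (\<lambda>u. indicator (- cbox (- real n) (real n)) u * G u))"
  obtain M where M: "M > 0" "\<And>r \<phi> u. r \<ge> 0 \<Longrightarrow> \<bar>Im \<phi>\<bar> \<le> r \<Longrightarrow> norm (F \<phi> u) \<le> M * exp ((5 + r) * ln (5 + r)) * G u"
    unfolding F_def G_def using disc_integrand_bound by blast
  have G: "integrable lborel G" "\<And>u. G u \<ge> 0"
    unfolding G_def by (rule integrable_disc_majorant) auto
  have F: "integrable lborel (F \<phi>)" for \<phi>
    unfolding F_def by (rule disc_fourier_integrable)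
  have F_cont: "continuous_on A (F \<phi>)" for \<phi> A
    unfolding F_def by (intro continuous_intros continuous_on_subset[OF continuous_disc_kernel]) auto
  have ind_G: "integrable lborel (\<lambda>u. indicator (- cbox (- real n) (real n)) u * G u)" for n
    using integrable_mult_indicator[OF _ G(1), of "- cbox (- real n) (real n)"] by simp
  have T: "T \<longlonglongrightarrow> 0"
  proof -
    have "T \<longlonglongrightarrow> integral\<^sup>L lborel (\<lambda>u :: real. 0 :: real)"
      unfolding T_def
    proof (rule integral_dominated_convergence[where w = G])
      show "AE u in lborel. (\<lambda>n. indicator (- cbox (- real n) (real n)) u * G u) \<longlonglongrightarrow> 0"
      proof (rule AE_I2)
        fix u :: real
        have "\<forall>\<^sub>F n in sequentially. real n \<ge> \<bar>u\<bar>"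
          by real_asymp
        hence "\<forall>\<^sub>F n in sequentially. indicator (- cbox (- real n) (real n)) u * G u = 0"
          by eventually_elim (auto simp: indicator_def)
        thus "(\<lambda>n. indicator (- cbox (- real n) (real n)) u * G u) \<longlonglongrightarrow> 0"
          by (rule tendsto_eventually)
      qed
      show "AE u in lborel. norm (indicator (- cbox (- real n) (real n)) u * G u) \<le> G u" for n
        by (rule AE_I2) (use G(2) in \<open>auto simp: indicator_def\<close>)
      show "(\<lambda>u. indicator (- cbox (- real n) (real n)) u * G u) \<in> borel_measurable lborel" for n
        using ind_G by (rule borel_measurable_integrable)
    qed (use G in auto)
    thus ?thesis by simp
  qed
  have close: "norm (f n \<phi> - disc_fourier \<phi>) \<le> M * exp ((5 + r) * ln (5 + r)) * T n"
    if r: "r \<ge> 0" "\<bar>Im \<phi>\<bar> \<le> r" for n \<phi> r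
  proof -
    let ?B = "cbox (- real n) (real n)"
    have si: "set_integrable lborel A (F \<phi>)" if "A \<in> sets borel" for A
      unfolding set_integrable_def using F that by (intro integrable_mult_indicator) auto
    have "f n \<phi> = integral\<^sup>L lborel (\<lambda>u. indicator ?B u *\<^sub>R F \<phi> u)"
      unfolding f_def using set_borel_integral_eq_integral(2)[OF si[of ?B]]
      by (simp add: set_lebesgue_integral_def)
    moreover have "disc_fourier \<phi> = integral\<^sup>L lborel (F \<phi>)"
      unfolding disc_fourier_def F_def ..
    ultimately have "disc_fourier \<phi> - f n \<phi> = integral\<^sup>L lborel (\<lambda>u. F \<phi> u - indicator ?B u *\<^sub>R F \<phi> u)"
      using F si[of ?B] by (simp add: set_integrable_def Bochner_Integration.integral_diff)
    also have "(\<lambda>u. F \<phi> u - indicator ?B u *\<^sub>R F \<phi> u) = (\<lambda>u. indicator (- ?B) u *\<^sub>R F \<phi> u)"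
      by (auto simp: fun_eq_iff indicator_def)
    also have "norm (integral\<^sup>L lborel \<dots>) \<le> integral\<^sup>L lborel (\<lambda>u. M * exp ((5 + r) * ln (5 + r)) * (indicator (- ?B) u * G u))"
    proof (rule order_trans[OF integral_norm_bound integral_mono])
      show "integrable lborel (\<lambda>u. norm (indicator (- ?B) u *\<^sub>R F \<phi> u))"
        using si[of "- ?B"] by (intro integrable_norm) (simp add: set_integrable_def)
      show "integrable lborel (\<lambda>u. M * exp ((5 + r) * ln (5 + r)) * (indicator (- ?B) u * G u))"
        by (intro integrable_mult_right ind_G)
      show "norm (indicator (- ?B) u *\<^sub>R F \<phi> u) \<le> M * exp ((5 + r) * ln (5 + r)) * (indicator (- ?B) u * G u)" for u
        using M(2)[OF r, of u] by (auto simp: indicator_def)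
    qed
    also have "\<dots> = M * exp ((5 + r) * ln (5 + r)) * T n"
      by (simp add: T_def)
    finally show ?thesis by (simp add: norm_minus_commute)
  qed
  show ?thesis
  proof (rule holomorphic_uniform_sequence[where f = f])
    show "f n holomorphic_on UNIV" for n
      unfolding f_def
    proof (rule leibniz_rule_holomorphic)
      show "((\<lambda>x. F x t) has_field_derivative (of_real (disc_kernel t) * (\<i> * of_real t * exp (\<i> * x * of_real t)))) (at x within UNIV)" for x t
        unfolding F_def by (auto intro!: derivative_eq_intros)
      show "continuous_on (UNIV \<times> cbox (- real n) (real n)) (\<lambda>(x, t). of_real (disc_kernel t) * (\<i> * of_real t * exp (\<i> * x * of_real t)))"
        unfolding case_prod_unfold
        by (intro continuous_intros continuous_on_compose2[OF continuous_disc_kernel]) auto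
    next
      show "F \<phi> integrable_on cbox (- real n) (real n)" for \<phi>
        by (intro integrable_continuous F_cont)
    qed auto
    fix z :: complex
    define c where "c = M * exp ((5 + (norm z + 1)) * ln (5 + (norm z + 1)))"
    have "uniform_limit (cball z 1) f disc_fourier sequentially"
    proof (rule uniform_limitI)
      fix e :: real assume e: "e > 0"
      have "(\<lambda>n. c * T n) \<longlonglongrightarrow> 0"
        using tendsto_mult_right_zero[OF T] .
      hence "\<forall>\<^sub>F n in sequentially. c * T n < e"
        using e by (rule order_tendstoD)
      thus "\<forall>\<^sub>F n in sequentially. \<forall>\<phi>\<in>cball z 1. dist (f n \<phi>) (disc_fourier \<phi>) < e"
      proof eventually_elim
        case (elim n)
        show ?case
        proof
          fix \<phi> assume "\<phi> \<in> cball z 1"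
          hence "norm \<phi> \<le> norm z + 1"
            using norm_triangle_sub[of \<phi> z] by (simp add: dist_norm norm_minus_commute)
          hence "\<bar>Im \<phi>\<bar> \<le> norm z + 1"
            using abs_Im_le_cmod[of \<phi>] by linarith
          hence "norm (f n \<phi> - disc_fourier \<phi>) \<le> c * T n"
            unfolding c_def by (intro close) auto
          with elim show "dist (f n \<phi>) (disc_fourier \<phi>) < e"
            by (simp add: dist_norm)
        qed
      qed
    qed
    thus "\<exists>d>0. cball z d \<subseteq> UNIV \<and> uniform_limit (cball z d) f disc_fourier sequentially"
      by (intro exI[of _ 1]) auto
  qed auto
qed

section \<open>Analytic continuation and order\<close>

text \<open>Inserting the q-series of \<Delta> and integrating term by term turns each summand into
  a Gamma integral. The exchange rests on \<open>tau_abs_summable\<close>, which is what reaches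
  down to 13/2; \<open>rGamma s\<close> then clears the Gamma factor.\<close>

lemma disc_fourier_mellin:
  assumes s: "Re s > 13 / 2"
  shows "(\<lambda>l. of_int (ramanujan_tau (Suc l)) * of_nat (Suc l) powr (- s)) sums
           (of_real (2 * pi) powr s * rGamma s * disc_fourier (- \<i> * (s - 6)))"
proof -
  define \<sigma> where "\<sigma> = Re s"
  have \<sigma>: "\<sigma> > 13/2" using s by (simp add: \<sigma>_def)
  define E where "E = (\<lambda>l u. exp (s * of_real u - of_real (2 * pi * real (Suc l) * exp u)))"
  define F where "F = (\<lambda>l u. of_int (ramanujan_tau (Suc l)) * E l u)"
  have nE: "norm (E l u) = exp (\<sigma> * u - 2 * pi * real (Suc l) * exp u)" for l u
    by (simp add: E_def \<sigma>_def)
  have E_int: "integrable lborel (E l)" "integral\<^sup>L lborel (E l) = of_real (2 * pi * real (Suc l)) powr (- s) * Gamma s" for l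
    unfolding E_def using log_Gamma_integral[of s "2 * pi * real (Suc l)"] s by simp_all
  have nF: "norm (F l u) = \<bar>real_of_int (ramanujan_tau (Suc l))\<bar> * exp (\<sigma> * u - 2 * pi * real (Suc l) * exp u)" for l u
    by (simp add: F_def norm_mult nE)
  have nF_int: "integral\<^sup>L lborel (\<lambda>u. norm (F l u)) = (\<bar>real_of_int (ramanujan_tau (Suc l))\<bar> * real (Suc l) powr (- \<sigma>)) * ((2 * pi) powr (- \<sigma>) * Gamma \<sigma>)" for l
  proof -
    have "integral\<^sup>L lborel (\<lambda>u. norm (F l u)) = \<bar>real_of_int (ramanujan_tau (Suc l))\<bar> * ((2 * pi * real (Suc l)) powr (- \<sigma>) * Gamma \<sigma>)"
      unfolding nF using log_Gamma_integral_real(2)[of \<sigma> "2 * pi * real (Suc l)"] \<sigma> by simp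
    also have "(2 * pi * real (Suc l)) powr (- \<sigma>) = (2 * pi) powr (- \<sigma>) * real (Suc l) powr (- \<sigma>)"
      by (rule powr_mult)
    finally show ?thesis by (simp only: mult_ac)
  qed
  have F_int: "integrable lborel (F l)" for l
    unfolding F_def by (intro integrable_mult_right E_int)
  have sum_F: "summable (\<lambda>l. norm (F l u))" for u
  proof -
    have "summable (\<lambda>l. \<bar>real_of_int (ramanujan_tau (Suc l))\<bar> * exp (- 2 * pi * exp u * real (Suc l)))"
      using tau_abs_summable_exp[of "exp u"] by (subst summable_Suc_iff) simp
    from summable_mult[OF this, of "exp (\<sigma> * u)"]
    moreover have "exp (\<sigma> * u - 2 * pi * real (Suc l) * exp u) = exp (\<sigma> * u) * exp (- 2 * pi * exp u * real (Suc l))" for l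
      by (simp only: exp_add[symmetric]) (simp add: mult_ac)
    ultimately show ?thesis
      unfolding nF by (simp only: mult_ac)
  qed
  have "(\<lambda>l. integral\<^sup>L lborel (F l)) sums integral\<^sup>L lborel (\<lambda>u. \<Sum>l. F l u)"
  proof (rule sums_integral[OF F_int])
    show "AE u in lborel. summable (\<lambda>l. norm (F l u))"
      using sum_F by (intro AE_I2)
    show "summable (\<lambda>l. integral\<^sup>L lborel (\<lambda>u. norm (F l u)))"
      unfolding nF_int by (intro summable_mult2 tau_abs_summable \<sigma>)
  qed
  \<comment> \<open>Splitting \<open>exp (6 * u)\<close> off \<open>exp (s * u)\<close> completes
    \<Delta> to the kernel; the remaining \<open>exp ((s - 6) * u)\<close> is the Fourier factor at
    \<open>\<phi> = - \<i> * (s - 6)\<close>.\<close>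
  also have "(\<lambda>u. \<Sum>l. F l u) = (\<lambda>u. of_real (disc_kernel u) * exp (\<i> * (- \<i> * (s - 6)) * of_real u))"
  proof
    fix u :: real
    let ?t = "\<i> * complex_of_real (exp u)"
    have e: "nome ?t ^ Suc l * exp (s * of_real u) = E l u" for l
    proof -
      have "2 * of_real pi * \<i> * (of_nat (Suc l) * ?t) + s * of_real u = s * of_real u - of_real (2 * pi * real (Suc l) * exp u)"
        by (simp add: algebra_simps complex_eq_iff)
      thus ?thesis
        unfolding E_def nome_power unfolding nome_def exp_add[symmetric] by (simp only:)
    qed
    have "(\<lambda>l. of_int (ramanujan_tau (Suc l)) * nome ?t ^ Suc l * exp (s * of_real u)) sums (discr ?t * exp (s * of_real u))"
      by (intro sums_mult2 discr_sums) simp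
    hence "(\<lambda>l. F l u) sums (discr ?t * exp (s * of_real u))"
      unfolding F_def e[symmetric] by (simp only: mult.assoc)
    hence "(\<Sum>l. F l u) = discr ?t * exp (s * of_real u)"
      by (rule sums_unique[symmetric])
    also have "exp (s * of_real u) = of_real (exp (6 * u)) * exp ((s - 6) * of_real u)"
      by (simp add: exp_of_real[symmetric] exp_add[symmetric] algebra_simps)
    also have "discr ?t * \<dots> = of_real (disc_kernel u) * exp ((s - 6) * of_real u)"
      using disc_kernel_pos_eq(2)[of u] by (simp add: mult.assoc[symmetric])
    also have "s - 6 = \<i> * (- \<i> * (s - 6))"
      by (simp add: mult.assoc[symmetric])
    finally show "(\<Sum>l. F l u) = of_real (disc_kernel u) * exp (\<i> * (- \<i> * (s - 6)) * of_real u)" .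
  qed
  also have "integral\<^sup>L lborel \<dots> = disc_fourier (- \<i> * (s - 6))"
    unfolding disc_fourier_def ..
  also have "(\<lambda>l. integral\<^sup>L lborel (F l)) = (\<lambda>l. of_real (2 * pi) powr (- s) * Gamma s * (of_int (ramanujan_tau (Suc l)) * of_nat (Suc l) powr (- s)))"
  proof
    fix l
    have "of_real (2 * pi * real (Suc l)) powr (- s) = of_real (2 * pi) powr (- s) * complex_of_real (real (Suc l)) powr (- s)"
      unfolding of_real_mult[of "2 * pi" "real (Suc l)"] by (rule powr_times_real) auto
    thus "integral\<^sup>L lborel (F l) = of_real (2 * pi) powr (- s) * Gamma s * (of_int (ramanujan_tau (Suc l)) * of_nat (Suc l) powr (- s))"
      unfolding F_def using E_int[of l] by simp
  qed
  finally have sums: "(\<lambda>l. of_real (2 * pi) powr (- s) * Gamma s * (of_int (ramanujan_tau (Suc l)) * of_nat (Suc l) powr (- s)))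
     sums disc_fourier (- \<i> * (s - 6))" .
  have "s \<notin> \<int>\<^sub>\<le>\<^sub>0"
    using s by (auto elim!: nonpos_Ints_cases)
  hence G: "rGamma s * Gamma s = 1"
    by (simp add: Gamma_def rGamma_eq_zero_iff)
  have "of_real (2 * pi) powr s * of_real (2 * pi) powr (- s) = (1 :: complex)"
    by (simp add: powr_minus)
  hence "of_real (2 * pi) powr s * rGamma s * (of_real (2 * pi) powr (- s) * Gamma s * x) = x" for x
    using G by (metis mult.assoc mult.commute mult.left_commute mult_1)
  with sums_mult[OF sums, of "of_real (2 * pi) powr s * rGamma s"] show ?thesis
    by (simp only:)
qed

text \<open>This settles the existence left open by the definite description: \<open>rGamma\<close>
  and \<open>disc_fourier\<close> are entire, so the right side is too. Any other candidate agrees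
  with it on a half-plane, hence everywhere.\<close>

lemma ramanujan_zeta_eq:
  "ramanujan_zeta = (\<lambda>s. of_real (2 * pi) powr s * rGamma s * disc_fourier (- \<i> * (s - 6)))"
  (is "_ = ?H")
  unfolding ramanujan_zeta_def
proof (rule the_equality)
  have "(\<lambda>s. disc_fourier (- \<i> * (s - 6))) holomorphic_on UNIV"
    by (rule holomorphic_on_compose_gen[OF _ disc_fourier_holomorphic, unfolded o_def])
       (auto intro!: holomorphic_intros)
  hence H: "?H holomorphic_on UNIV"
    by (intro holomorphic_intros) auto
  show "?H holomorphic_on UNIV \<and>
     (\<forall>x. Re x > 13 / 2 \<longrightarrow> (\<lambda>l. of_int (ramanujan_tau (Suc l)) * of_nat (Suc l) powr (- x)) sums ?H x)"
    using H disc_fourier_mellin by blast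
  fix K assume K: "K holomorphic_on UNIV \<and>
     (\<forall>x. Re x > 13 / 2 \<longrightarrow> (\<lambda>l. of_int (ramanujan_tau (Suc l)) * of_nat (Suc l) powr (- x)) sums K x)"
  have eq: "K x = ?H x" if "x \<in> {x. Re x > 13 / 2}" for x
    using K disc_fourier_mellin[of x] that sums_unique2 by blast
  show "K = ?H"
  proof
    fix x
    show "K x = ?H x"
    proof (rule analytic_continuation_open[of "{x. Re x > 13 / 2}" UNIV K ?H])
      show "{x. Re x > 13 / 2} \<noteq> ({} :: complex set)"
        by (auto intro: exI[of _ 7])
      show "open {x. Re x > 13 / 2}"
        by (rule open_halfspace_Re_gt)
    qed (use K H eq in auto)
  qed
qed

text \<open>Off the poles \<open>Gamma\<close> and \<open>rGamma\<close> cancel, so near each point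
  the unextended product agrees with a continuous function, whose value is the limit taken by
  \<open>remove_sings\<close>.\<close>

lemma ramanujan_rankin_xi_eq: "ramanujan_rankin_xi s = disc_fourier (- \<i> * (s - 6))"
proof -
  have "(\<lambda>s. disc_fourier (- \<i> * (s - 6))) holomorphic_on UNIV"
    by (rule holomorphic_on_compose_gen[OF _ disc_fourier_holomorphic, unfolded o_def])
       (auto intro!: holomorphic_intros)
  hence "isCont (\<lambda>s. disc_fourier (- \<i> * (s - 6))) s"
    by (intro analytic_at_imp_isCont holomorphic_on_imp_analytic_at) auto
  hence lim: "(\<lambda>s. disc_fourier (- \<i> * (s - 6))) \<midarrow>s\<rightarrow> disc_fourier (- \<i> * (s - 6))"
    by (simp add: isCont_def)
  \<comment> \<open>The poles form a discrete closed set, so \<open>s\<close> has a punctured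
    neighbourhood free of poles even when \<open>s\<close> is one itself.\<close>
  have "closed (\<int>\<^sub>\<le>\<^sub>0 - {s})"
    by (rule closed_subset_Ints) auto
  hence "\<forall>\<^sub>F x in nhds s. x \<in> - (\<int>\<^sub>\<le>\<^sub>0 - {s})"
    by (intro eventually_nhds_in_open open_Compl) auto
  hence "\<forall>\<^sub>F x in at s. x \<notin> \<int>\<^sub>\<le>\<^sub>0"
    by (auto simp: eventually_at_filter elim: eventually_mono)
  hence "\<forall>\<^sub>F x in at s. disc_fourier (- \<i> * (x - 6)) = of_real (2 * pi) powr (- x) * Gamma x * ramanujan_zeta x"
  proof eventually_elim
    case (elim x)
    hence G: "Gamma x * rGamma x = 1"
      by (simp add: Gamma_def rGamma_eq_zero_iff)
    have "of_real (2 * pi) powr (- x) * of_real (2 * pi) powr x = (1 :: complex)"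
      by (simp add: powr_minus)
    hence "of_real (2 * pi) powr (- x) * Gamma x * (of_real (2 * pi) powr x * rGamma x * y) = y" for y
      using G by (metis mult.assoc mult.commute mult.left_commute mult_1)
    thus ?case by (simp add: ramanujan_zeta_eq)
  qed
  thus ?thesis
    unfolding ramanujan_rankin_xi_def
    by (intro remove_sings_eqI Lim_transform_eventually[OF lim])
qed

lemma ramanujan_wilton_eq: "ramanujan_wilton = disc_fourier"
  by (simp add: fun_eq_iff ramanujan_wilton_def ramanujan_rankin_xi_eq mult.assoc[symmetric])

section \<open>The order of growth\<close>

lemma disc_fourier_lower:
  "\<forall>\<^sub>F r in at_top. exp r \<le> norm (disc_fourier (- \<i> * of_real r))"
proof -
  have "\<exists>u0\<in>{2..3::real}. \<forall>u\<in>{2..3}. disc_kernel u0 \<le> disc_kernel u"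
    by (rule continuous_attains_inf) (auto intro: continuous_on_subset[OF continuous_disc_kernel])
  then obtain u0 where u0: "\<And>u. u \<in> {2..3} \<Longrightarrow> disc_kernel u0 \<le> disc_kernel u"
    by blast
  define c where "c = disc_kernel u0"
  have c: "c > 0" unfolding c_def by (rule disc_kernel_pos_eq)
  \<comment> \<open>On the negative imaginary axis the integrand
    \<open>disc_kernel u * exp (r * u)\<close> is positive, so restricting it to
    \<open>{2..3}\<close>, an interval of length 1, gives a lower bound.\<close>
  have lower: "c * exp (2 * r) \<le> norm (disc_fourier (- \<i> * of_real r))" if r: "r \<ge> 0" for r
  proof -
    have e: "of_real (disc_kernel u) * exp (\<i> * (- \<i> * of_real r) * of_real u) = (of_real (disc_kernel u * exp (r * u)) :: complex)" for u
      by (simp add: exp_of_real[symmetric] mult.assoc[symmetric])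
    have int: "integrable lborel (\<lambda>u. disc_kernel u * exp (r * u))"
      using disc_fourier_integrable[of "- \<i> * of_real r"] unfolding e complex_of_real_integrable_eq .
    have eq: "disc_fourier (- \<i> * of_real r) = of_real (integral\<^sup>L lborel (\<lambda>u. disc_kernel u * exp (r * u)))"
      unfolding disc_fourier_def e by (rule integral_complex_of_real)
    have "c * exp (2 * r) = integral\<^sup>L lborel (\<lambda>u. indicator {2..3::real} u * (c * exp (2 * r)))"
      by simp
    also have "\<dots> \<le> integral\<^sup>L lborel (\<lambda>u. disc_kernel u * exp (r * u))"
    proof (rule integral_mono[OF _ int])
      show "integrable lborel (\<lambda>u :: real. indicator {2..3} u * (c * exp (2 * r)))"
        by simp
      fix u :: real
      show "indicator {2..3} u * (c * exp (2 * r)) \<le> disc_kernel u * exp (r * u)"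
      proof (cases "u \<in> {2..3}")
        case True
        hence "c * exp (2 * r) \<le> disc_kernel u * exp (r * u)"
          using u0[OF True] r c mult_left_mono[of 2 u r]
          by (intro mult_mono) (auto simp: c_def mult.commute)
        thus ?thesis using True by simp
      next
        case False
        thus ?thesis using disc_kernel_pos_eq(1)[of u] by simp
      qed
    qed
    also have "\<dots> \<le> norm (disc_fourier (- \<i> * of_real r))"
      unfolding eq norm_of_real by (rule abs_ge_self)
    finally show ?thesis .
  qed
  \<comment> \<open>Starting the interval at 2 rather than 1 leaves a spare \<open>exp r\<close>
    that absorbs the unknown constant \<open>c\<close>.\<close>
  have "\<forall>\<^sub>F r in at_top. exp r \<le> c * exp (2 * r)"
    using c by real_asymp
  thus ?thesis
    using eventually_ge_at_top[of 0]
  proof eventually_elim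
    case (elim r)
    thus ?case using lower[of r] by simp
  qed
qed

text \<open>The lower bound makes the double logarithm of the maximum modulus at least
  \<open>ln r\<close>. The upper bound makes it at most the logarithm of
  \<open>ln M + (5 + r) * ln (5 + r)\<close>, which is asymptotic to \<open>ln r\<close>. The
  quotient is thus squeezed to a genuine limit 1.\<close>

lemma growth_order_disc_fourier: "growth_order disc_fourier = 1"
proof -
  obtain M where M: "M > 0" "\<And>\<phi>. norm (disc_fourier \<phi>) \<le> M * exp ((5 + norm \<phi>) * ln (5 + norm \<phi>))"
    by (rule disc_fourier_growth) blast
  define Q where "Q = (\<lambda>r. ln (ln (max_modulus disc_fourier r)) / ln r)"
  have upper: "max_modulus disc_fourier r \<le> M * exp ((5 + r) * ln (5 + r))" if "r \<ge> 0" for r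
    unfolding max_modulus_def
  proof (rule cSUP_least)
    show "sphere (0::complex) r \<noteq> {}" using that by simp
  qed (use M(2) in auto)
  have ge: "norm (disc_fourier z) \<le> max_modulus disc_fourier r" if "norm z = r" for z r
    unfolding max_modulus_def
  proof (rule cSUP_upper)
    show "bdd_above ((\<lambda>z. norm (disc_fourier z)) ` sphere 0 r)"
      using M(2) by (intro bdd_aboveI[of _ "M * exp ((5 + r) * ln (5 + r))"]) (force intro: M(2))
  qed (use that in auto)
  have ev: "\<forall>\<^sub>F r in at_top. 1 \<le> Q r \<and> Q r \<le> ln (ln (M * exp ((5 + r) * ln (5 + r)))) / ln r"
    using disc_fourier_lower eventually_gt_at_top[of 1]
  proof eventually_elim
    case (elim r)
    have lo: "exp r \<le> max_modulus disc_fourier r"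
      using elim ge[of "- \<i> * of_real r" r] by (simp add: norm_mult)
    have pos: "max_modulus disc_fourier r > 0"
      using lo exp_gt_zero[of r] by linarith
    have l1: "r \<le> ln (max_modulus disc_fourier r)"
      using lo pos by (simp add: ln_ge_iff)
    have l2: "ln r \<le> ln (ln (max_modulus disc_fourier r))"
      using l1 elim by simp
    have "ln (max_modulus disc_fourier r) \<le> ln (M * exp ((5 + r) * ln (5 + r)))"
      using upper[of r] pos elim by (intro ln_mono) auto
    moreover have "0 < ln (max_modulus disc_fourier r)"
      using l1 elim by linarith
    ultimately have "ln (ln (max_modulus disc_fourier r)) \<le> ln (ln (M * exp ((5 + r) * ln (5 + r))))"
      by (rule ln_mono)
    thus ?case
      unfolding Q_def using l2 elim by (auto intro!: divide_right_mono simp: le_divide_eq)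
  qed
  have lim: "((\<lambda>r. ln (ln (M * exp ((5 + r) * ln (5 + r)))) / ln r) \<longlongrightarrow> 1) at_top"
    using M(1) by real_asymp
  have "(Q \<longlongrightarrow> 1) at_top"
    by (rule tendsto_sandwich[OF _ _ tendsto_const lim]) (use ev in \<open>auto elim: eventually_mono\<close>)
  hence "((\<lambda>r. ereal (Q r)) \<longlongrightarrow> ereal 1) at_top"
    by (rule tendsto_ereal)
  hence "Limsup at_top (\<lambda>r. ereal (Q r)) = ereal 1"
    by (intro lim_imp_Limsup) auto
  thus ?thesis
    by (simp add: growth_order_def Q_def one_ereal_def)
qed

theorem proposition3:
  shows "ramanujan_wilton holomorphic_on UNIV \<and>
         (\<forall>\<phi>. ramanujan_wilton (- \<phi>) = ramanujan_wilton \<phi>) \<and>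
         growth_order ramanujan_wilton = 1"
  unfolding ramanujan_wilton_eq
  using disc_fourier_holomorphic disc_fourier_even growth_order_disc_fourier by blast

end
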